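(* Let $q$ be a prime power and $d\ge 4$, with $q$ odd if $d$ is odd. Let $\zeta$ be a generator of the cyclic group $\mathbb F_{q^2}^\times$ and let $\zeta_1=\zeta^{q-1}$, which generates the subgroup $\mathbb F_{q^2}^1=\{x\in\mathbb F_{q^2}\mid x\bar x=1\}$. (i) If $d=2l$, then the group $\mathrm{U}(d,q^2)$ is generated by the elementary matrices together with $h(\zeta)=\operatorname{diag}(1,\dots,1,\zeta,1,\dots,1,\bar\zeta^{-1})$, with $\zeta$ in position $l$ and $\bar\zeta^{-1}$ in position $-l$. (ii) If $d=2l+1$, then the group $\mathrm{U}(d,q^2)$ is generated by the elementary matrices together with $h(\zeta)=\operatorname{diag}(1,\dots,1,\zeta,1,\dots,1,\bar\zeta^{-1})$, with $\zeta$ in position $l$ and $\bar\zeta^{-1}$ in position $-l$, and $h(\zeta_1)=\operatorname{diag}(\zeta_1,1,\dots,1)$, with $\zeta_1$ in position $0$.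
   Context: Let $\mathcal K=\mathbb F_{q^2}$ with the automorphism $x\mapsto\bar x=x^q$ of order $2$ and fixed field $\mathbb F_q$. $\mathcal K^o=\{x\in\mathcal K\mid \bar x=-x\}$. For a matrix $X$, $\bar X$ denotes entrywise application of the automorphism and ${}^TX$ the transpose. Rows and columns are indexed by $1,\dots,l,-1,\dots,-l$ (in this order) if $d=2l$, and by $0,1,\dots,l,-1,\dots,-l$ (in this order) if $d=2l+1$, with $l\ge 2$. Set $\beta=\begin{pmatrix} 0 & I_l \\ I_l & 0 \end{pmatrix}$ if $d=2l$ and $\beta=\begin{pmatrix} 2 & 0 & 0 \\ 0 & 0 & I_l \\ 0 & I_l & 0 \end{pmatrix}$ if $d=2l+1$. Then $\mathrm{U}(d,q^2)=\{X\in \mathrm{GL}(d,\mathbb F_{q^2})\mid {}^T\bar X\beta X=\beta\}$. Let $e_{a,b}$ be the matrix unit with $1$ in position $(a,b)$ and $0$ elsewhere. For $1\le i,j\le l$, $t\in\mathcal K$, $s\in\mathcal K^o$, the elementary matrices of $\mathrm{U}(2l,q^2)$ are $x_{i,j}(t)=I+te_{i,j}-\bar t e_{-j,-i}$ ($i\ne j$); $x_{i,-j}(t)=I+te_{i,-j}-\bar t e_{j,-i}$ ($i<j$); $x_{-i,j}(t)=I+te_{-i,j}-\bar t e_{-j,i}$ ($i<j$); $x_{i,-i}(s)=I+se_{i,-i}$; $x_{-i,i}(s)=I+se_{-i,i}$. The elementary matrices of $\mathrm{U}(2l+1,q^2)$ are those given by the same formulas (as matrices of size $2l+1$) together with $x_{i,0}(t)=I-2\bar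 t e_{i,0}+te_{0,-i}-t\bar t e_{i,-i}$ and $x_{0,i}(t)=I+te_{0,i}-2\bar t e_{-i,0}-t\bar t e_{-i,i}$. *)

theory Defs
  imports
    "HOL-Library.Cardinality"
    "HOL-Number_Theory.Prime_Powers"
    "HOL-Algebra.Generated_Groups"
    "Jordan_Normal_Form.Matrix"
begin

text \<open>
  The field with \<open>q\<^sup>2\<close> elements is a field type \<open>'a\<close> with \<open>CARD('a) = q\<^sup>2\<close>; throughout, \<open>q\<close> is
  an explicit parameter, the automorphism being \<open>bar q\<close>.
\<close>

definition bar :: "nat \<Rightarrow> 'a::field \<Rightarrow> 'a" where
  "bar q x = x ^ q"

definition skew_elems :: "nat \<Rightarrow> 'a::field set" where
  "skew_elems q = {x. bar q x = - x}"

text \<open>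
  Rows and columns are labelled by signed integers, in the order \<open>1, \<dots>, l, -1, \<dots>, -l\<close>
  if \<open>d = 2 l\<close>, and \<open>0, 1, \<dots>, l, -1, \<dots>, -l\<close> if \<open>d = 2 l + 1\<close>. The matrices of the library
  are indexed by \<open>0, \<dots>, d - 1\<close>; \<open>pos d k\<close> is the row (or column) number carrying the
  label \<open>k\<close>. It is meaningful only for labels \<open>k\<close> occurring in the list (so for even \<open>d\<close>
  not for \<open>k = 0\<close>).
\<close>

definition pos :: "nat \<Rightarrow> int \<Rightarrow> nat" where
  "pos d k = (if k \<ge> 0 then nat k else d div 2 + nat (- k)) - (if even d then 1 else 0)"

definition munit :: "nat \<Rightarrow> int \<Rightarrow> int \<Rightarrow> 'a::field mat" where
  "munit d a b = mat d d (\<lambda>(r, c). if r = pos d a \<and> c = pos d b then 1 else 0)"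

definition form_even :: "nat \<Rightarrow> 'a::field mat" where
  "form_even l = four_block_mat (0\<^sub>m l l) (1\<^sub>m l) (1\<^sub>m l) (0\<^sub>m l l)"

definition form_mat :: "nat \<Rightarrow> 'a::field mat" where
  "form_mat d = (let l = d div 2 in
     if even d then form_even l
     else four_block_mat (2 \<cdot>\<^sub>m 1\<^sub>m 1) (0\<^sub>m 1 (2 * l)) (0\<^sub>m (2 * l) 1) (form_even l))"

abbreviation GL :: "'a::field itself \<Rightarrow> nat \<Rightarrow> 'a mat monoid" where
  "GL ty d \<equiv> units_of (ring_mat ty d ())"

definition unitary :: "nat \<Rightarrow> nat \<Rightarrow> 'a::field mat set" where
  "unitary d q = {X \<in> carrier (GL TYPE('a) d).
     transpose_mat (map_mat (bar q) X) * form_mat d * X = form_mat d}"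

inductive_set elementary :: "nat \<Rightarrow> nat \<Rightarrow> 'a::field mat set" for d q :: nat where
  pos_pos: "i \<in> {1..int (d div 2)} \<Longrightarrow> j \<in> {1..int (d div 2)} \<Longrightarrow> i \<noteq> j \<Longrightarrow>
    1\<^sub>m d + t \<cdot>\<^sub>m munit d i j - bar q t \<cdot>\<^sub>m munit d (- j) (- i) \<in> elementary d q"
| pos_neg: "i \<in> {1..int (d div 2)} \<Longrightarrow> j \<in> {1..int (d div 2)} \<Longrightarrow> i < j \<Longrightarrow>
    1\<^sub>m d + t \<cdot>\<^sub>m munit d i (- j) - bar q t \<cdot>\<^sub>m munit d j (- i) \<in> elementary d q"
| neg_pos: "i \<in> {1..int (d div 2)} \<Longrightarrow> j \<in> {1..int (d div 2)} \<Longrightarrow> i < j \<Longrightarrow>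
    1\<^sub>m d + t \<cdot>\<^sub>m munit d (- i) j - bar q t \<cdot>\<^sub>m munit d (- j) i \<in> elementary d q"
| long_pos: "i \<in> {1..int (d div 2)} \<Longrightarrow> s \<in> skew_elems q \<Longrightarrow>
    1\<^sub>m d + s \<cdot>\<^sub>m munit d i (- i) \<in> elementary d q"
| long_neg: "i \<in> {1..int (d div 2)} \<Longrightarrow> s \<in> skew_elems q \<Longrightarrow>
    1\<^sub>m d + s \<cdot>\<^sub>m munit d (- i) i \<in> elementary d q"
| odd_pos: "odd d \<Longrightarrow> i \<in> {1..int (d div 2)} \<Longrightarrow>
    1\<^sub>m d - (2 * bar q t) \<cdot>\<^sub>m munit d i 0 + t \<cdot>\<^sub>m munit d 0 (- i)
      - (t * bar q t) \<cdot>\<^sub>m munit d i (- i) \<in> elementary d q"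
| odd_neg: "odd d \<Longrightarrow> i \<in> {1..int (d div 2)} \<Longrightarrow>
    1\<^sub>m d + t \<cdot>\<^sub>m munit d 0 i - (2 * bar q t) \<cdot>\<^sub>m munit d (- i) 0
      - (t * bar q t) \<cdot>\<^sub>m munit d (- i) i \<in> elementary d q"

definition h_last :: "nat \<Rightarrow> nat \<Rightarrow> 'a::field \<Rightarrow> 'a mat" where
  "h_last d q z = (let l = int (d div 2) in
     mat_diag d (\<lambda>r. if r = pos d l then z else if r = pos d (- l) then inverse (bar q z) else 1))"

text \<open>Used for odd \<open>d\<close> only, where the label \<open>0\<close> exists.\<close>

definition h_zero :: "nat \<Rightarrow> 'a::field \<Rightarrow> 'a mat" where
  "h_zero d z = mat_diag d (\<lambda>r. if r = pos d 0 then z else 1)"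

end

theory Submission
  imports Defs "HOL-Number_Theory.Residues" "Jordan_Normal_Form.Determinant"
begin

text \<open>
  Left multiplication by an elementary matrix is a row operation, so generation is an elimination
  argument. Suppose \<open>X\<close> is unitary and fixes the basis vectors \<open>e\<^sub>i\<close> and \<open>e\<^sub>-\<^sub>i\<close> for all
  \<open>0 < i < k\<close>. Column \<open>k\<close> of \<open>X\<close> is isotropic and nonzero, so row operations make its entry \<open>l\<close>
  nonzero and then its entry \<open>k\<close> equal to \<open>1\<close>; the diagonal matrix \<open>h(\<zeta>)\<close> is needed only when
  \<open>k = l\<close>. Further row operations clear the entries of the column other than \<open>\<plusminus>k\<close>, and then
  isotropy forces the entry \<open>-k\<close> to be skew, so that a long root element removes it. Column \<open>-k\<close>
  has entry \<open>1\<close> at \<open>-k\<close> by unitarity and is cleared the same way. After \<open>l\<close> rounds only a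
  diagonal matrix supported at the label \<open>0\<close> remains.
\<close>

section \<open>The finite field and its involution\<close>

locale finite_unitary =
  fixes q d :: nat and \<zeta> :: "'a::field"
  assumes primepow_q: "primepow q"
    and card_field: "CARD('a) = q ^ 2"
    and d_ge: "d \<ge> 2"
    and odd_q: "odd d \<Longrightarrow> odd q"
    and generator: "range (\<lambda>k::int. \<zeta> powi k) = UNIV - {0}"
begin

lemma q_gt_1: "q > 1"
  using primepow_gt_Suc_0[OF primepow_q] by simp

lemma finite_UNIV_field: "finite (UNIV :: 'a set)"
  using card_field q_gt_1 card_ge_0_finite[of "UNIV :: 'a set"] by simp

lemma prime_CHAR: "prime CHAR('a)"
  using finite_imp_CHAR_pos[OF finite_UNIV_field] prime_CHAR_semidom by blast

text \<open>The characteristic divides the cardinality \<open>q ^ 2\<close>, hence the prime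
  underlying \<open>q\<close>. So \<open>bar q\<close> is an iterate of the Frobenius map, which
  makes it additive.\<close>

lemma q_power_CHAR: obtains n where "n > 0" "q = CHAR('a) ^ n"
proof -
  obtain p n where p: "prime p" "n > 0" "q = p ^ n"
    using primepow_q by (auto simp: primepow_def)
  have "CHAR('a) dvd q ^ 2"
    using CHAR_dvd_CARD[where 'a='a] card_field by simp
  then have "CHAR('a) dvd p"
    using p prime_CHAR prime_dvd_power by blast
  then have "CHAR('a) = p"
    using p prime_CHAR primes_dvd_imp_eq by blast
  with p that show thesis by blast
qed

lemma bar_add: "bar q (x + y) = bar q x + bar q (y :: 'a)"
proof -
  obtain n where "q = CHAR('a) ^ n" using q_power_CHAR .
  then show ?thesis
    unfolding bar_def by (rule freshmans_dream'[OF prime_CHAR])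
qed

lemma bar_mult: "bar q (x * y) = bar q x * bar q (y :: 'a)"
  by (simp add: bar_def power_mult_distrib)

lemma bar_0: "bar q (0 :: 'a) = 0"
  using q_gt_1 by (simp add: bar_def)

lemma bar_1: "bar q (1 :: 'a) = 1"
  by (simp add: bar_def)

lemma bar_minus: "bar q (- x) = - bar q (x :: 'a)"
  using bar_add[of x "- x"] by (simp add: bar_0 eq_neg_iff_add_eq_0 add.commute)

lemma bar_diff: "bar q (x - y) = bar q x - bar q (y :: 'a)"
  using bar_add[of x "- y"] by (simp add: bar_minus)

lemma bar_2: "bar q (2 :: 'a) = 2"
  using bar_add[of 1 1] by (simp add: bar_1)

lemma bar_inverse: "bar q (inverse x) = inverse (bar q (x :: 'a))"
  by (simp add: bar_def power_inverse)

lemma bar_eq_0: "bar q x = 0 \<longleftrightarrow> x = (0 :: 'a)"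
  using q_gt_1 by (simp add: bar_def)

text \<open>Multiplication by \<open>x\<close> permutes the nonzero elements, so it multiplies their
  product by \<open>x ^ (q ^ 2 - 1)\<close> and yet leaves it unchanged.\<close>

lemma power_order_eq_1:
  fixes x :: 'a
  assumes "x \<noteq> 0"
  shows "x ^ (q ^ 2 - 1) = 1"
proof -
  let ?P = "\<Prod>y\<in>UNIV - {0}. y :: 'a"
  have nz: "?P \<noteq> 0"
    using finite_UNIV_field by simp
  have "?P = (\<Prod>y\<in>UNIV - {0}. x * y)"
    by (rule prod.reindex_bij_witness[of _ "\<lambda>y. x * y" "\<lambda>y. y / x"]) (use assms in auto)
  also have "\<dots> = x ^ card (UNIV - {0 :: 'a}) * ?P"
    by (simp add: prod.distrib)
  also have "card (UNIV - {0 :: 'a}) = q ^ 2 - 1"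
    using finite_UNIV_field card_field by simp
  finally show ?thesis using nz by simp
qed

lemma bar_bar: "bar q (bar q x) = (x :: 'a)"
proof (cases "x = 0")
  case True
  then show ?thesis by (simp add: bar_0)
next
  case False
  have "bar q (bar q x) = x ^ Suc (q ^ 2 - 1)"
    using q_gt_1 by (simp add: bar_def power2_eq_square power_mult del: power_Suc)
  then show ?thesis using power_order_eq_1[OF False] by simp
qed

lemma two_nonzero: "odd d \<Longrightarrow> (2 :: 'a) \<noteq> 0"
proof
  assume "odd d" "(2 :: 'a) = 0"
  then have "of_nat 2 = (0 :: 'a)" by simp
  then have "CHAR('a) dvd 2" by (simp only: of_nat_eq_0_iff_char_dvd)
  then have "CHAR('a) = 2" using prime_CHAR primes_dvd_imp_eq two_is_prime_nat by blast
  moreover obtain n where "n > 0" "q = CHAR('a) ^ n" using q_power_CHAR .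
  ultimately show False using odd_q[OF \<open>odd d\<close>] by simp
qed

section \<open>The order of the generator\<close>

lemma zeta_nonzero: "\<zeta> \<noteq> 0"
proof
  assume "\<zeta> = 0"
  then have "\<zeta> powi 1 \<in> {0}" by simp
  moreover have "\<zeta> powi 1 \<in> UNIV - {0}" using generator by blast
  ultimately show False by blast
qed

text \<open>Integer exponents become natural ones. This serves to count the powers of \<zeta>, and
  later to write the diagonal matrices as products of generators without inverses.\<close>

lemma powi_eq_power_mod:
  fixes x :: 'a
  assumes "x ^ n = 1" "n > 0"
  shows "x powi k = x ^ nat (k mod int n)"
proof -
  have "x \<noteq> 0" using assms by (auto simp: power_0_left)
  have "x powi k = x powi (int n * (k div int n) + k mod int n)"
    by simp
  also have "\<dots> = (x powi int n) powi (k div int n) * x powi (k mod int n)"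
    using \<open>x \<noteq> 0\<close> by (simp only: power_int_add power_int_mult simp_thms)
  also have "\<dots> = x ^ nat (k mod int n)"
    using assms by (simp add: power_int_def)
  finally show ?thesis .
qed

text \<open>If \<open>\<zeta> ^ n = 1\<close>, then the first \<open>n\<close> powers of \<zeta>
  already exhaust the \<open>q ^ 2 - 1\<close> nonzero elements.\<close>

lemma order_le:
  assumes "\<zeta> ^ n = 1" "n > 0"
  shows "q ^ 2 - 1 \<le> n"
proof -
  have "UNIV - {0} \<subseteq> (\<lambda>i. \<zeta> ^ i) ` {..<n}"
    unfolding generator[symmetric]
    using powi_eq_power_mod[OF assms] assms(2) by (auto simp: nat_less_iff)
  then have "card (UNIV - {0 :: 'a}) \<le> card ((\<lambda>i. \<zeta> ^ i) ` {..<n})"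
    by (rule card_mono[rotated]) simp
  also have "\<dots> \<le> n"
    using card_image_le[of "{..<n}" "\<lambda>i. \<zeta> ^ i"] by simp
  finally show ?thesis
    using finite_UNIV_field card_field by simp
qed

lemma order_dvd:
  assumes "\<zeta> powi k = 1"
  shows "int (q ^ 2 - 1) dvd k"
proof (rule ccontr)
  define n where "n = nat (k mod int (q ^ 2 - 1))"
  have pos: "q ^ 2 - 1 > 0"
    using one_less_power[OF q_gt_1, of 2] by simp
  assume "\<not> int (q ^ 2 - 1) dvd k"
  then have "k mod int (q ^ 2 - 1) \<noteq> 0"
    by (simp add: dvd_eq_mod_eq_0)
  moreover have "k mod int (q ^ 2 - 1) \<ge> 0" "k mod int (q ^ 2 - 1) < int (q ^ 2 - 1)"
    using pos by (simp_all only: pos_mod_sign pos_mod_bound of_nat_0_less_iff)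
  ultimately have "n > 0" "n < q ^ 2 - 1"
    unfolding n_def by linarith+
  moreover have "\<zeta> ^ n = 1"
    using powi_eq_power_mod[OF power_order_eq_1[OF zeta_nonzero] pos, of k] assms n_def by simp
  ultimately show False using order_le by fastforce
qed

text \<open>The norm of \<open>\<zeta> powi k\<close> is \<open>\<zeta> powi (k * (q + 1))\<close>.
  As \<zeta> has order (q - 1)(q + 1), this is 1 exactly when q - 1 divides
  \<open>k\<close>.\<close>

lemma norm_one_group:
  "range (\<lambda>k::int. (\<zeta> ^ (q - 1)) powi k) = {x. x * bar q x = 1}"
proof (intro equalityI subsetI)
  have factor: "int (q ^ 2 - 1) = int (q - 1) * int (q + 1)"
    using q_gt_1 by (simp add: of_nat_diff power2_eq_square algebra_simps)
  {
    fix x assume "x \<in> range (\<lambda>k::int. (\<zeta> ^ (q - 1)) powi k)"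
    then obtain k where x: "x = (\<zeta> ^ (q - 1)) powi k" by blast
    have "x * bar q x = x powi int (q + 1)"
      by (simp add: bar_def power_int_def nat_add_distrib)
    also have "\<dots> = (\<zeta> powi (int (q - 1) * int (q + 1))) powi k"
      unfolding x power_int_of_nat[symmetric] power_int_mult[symmetric] by (simp only: mult_ac)
    also have "\<dots> = 1"
      unfolding factor[symmetric] power_int_of_nat power_order_eq_1[OF zeta_nonzero] by simp
    finally show "x \<in> {x. x * bar q x = 1}" by simp
  next
    fix x :: 'a assume "x \<in> {x. x * bar q x = 1}"
    then have x: "x * bar q x = 1" by simp
    then have "x \<in> UNIV - {0}" by auto
    then obtain k where k: "x = \<zeta> powi k" using generator by blast
    have "\<zeta> powi (k * int (q + 1)) = x powi int (q + 1)"
      by (simp only: k power_int_mult)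
    also have "\<dots> = x * bar q x"
      by (simp add: bar_def power_int_def nat_add_distrib)
    finally have "int (q ^ 2 - 1) dvd k * int (q + 1)"
      using x order_dvd by simp
    then have "int (q - 1) dvd k"
      unfolding factor by (simp only: dvd_mult_cancel_right) simp
    then obtain m where "k = int (q - 1) * m" ..
    then have "x = (\<zeta> ^ (q - 1)) powi m"
      using k by (simp add: power_int_mult)
    then show "x \<in> range (\<lambda>k::int. (\<zeta> ^ (q - 1)) powi k)" by blast
  }
qed

text \<open>A difference x - \<open>bar q x\<close> is always skew. For \<zeta> it is nonzero, since
  otherwise \<zeta> ^ (q - 1) = 1, against the order of \<zeta>. The element is used to carry a
  nonzero entry from row -l to row l.\<close>

lemma obtain_skew:
  obtains s :: 'a where "s \<in> skew_elems q" "s \<noteq> 0"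
proof
  show "\<zeta> - bar q \<zeta> \<in> skew_elems q"
    by (simp add: skew_elems_def bar_diff bar_bar)
  show "\<zeta> - bar q \<zeta> \<noteq> 0"
  proof
    assume "\<zeta> - bar q \<zeta> = 0"
    then have "\<zeta> * \<zeta> ^ (q - 1) = \<zeta>"
      using q_gt_1 by (simp add: bar_def power_eq_if)
    then have "\<zeta> ^ (q - 1) = 1"
      using zeta_nonzero by simp
    then have "q ^ 2 - 1 \<le> q - 1"
      using order_le q_gt_1 by simp
    moreover have "q * 2 \<le> q ^ 2"
      using q_gt_1 by (simp add: power2_eq_square)
    ultimately show False using q_gt_1 by simp
  qed
qed

end

section \<open>Signed labels and the hermitian form\<close>

text \<open>Label 0 must be left out for even \<open>d\<close>: truncated subtraction then gives
  \<open>pos d 0 = pos d 1\<close>, and \<open>pos d\<close> would not be injective.\<close>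

definition labels :: "nat \<Rightarrow> int set" where
  "labels d = {a. \<bar>a\<bar> \<le> int (d div 2) \<and> (even d \<longrightarrow> a \<noteq> 0)}"

lemma finite_labels: "finite (labels d)"
  by (rule finite_subset[of _ "{- int (d div 2)..int (d div 2)}"]) (auto simp: labels_def)

lemma uminus_labels [simp]: "- a \<in> labels d \<longleftrightarrow> a \<in> labels d"
  by (auto simp: labels_def)

lemma pos_less: "a \<in> labels d \<Longrightarrow> pos d a < d"
  unfolding labels_def pos_def by (cases "even d") (auto elim!: evenE oddE)

lemma inj_on_pos: "inj_on (pos d) (labels d)"
  unfolding labels_def pos_def inj_on_def
  by (cases "even d") (auto elim!: evenE oddE split: if_splits)

lemma pos_eq_iff: "a \<in> labels d \<Longrightarrow> b \<in> labels d \<Longrightarrow> pos d a = pos d b \<longleftrightarrow> a = b"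
  using inj_on_pos by (rule inj_on_eq_iff)

lemma pos_surj:
  assumes "r < d"
  obtains a where "a \<in> labels d" "pos d a = r"
proof -
  \<comment> \<open>\<open>k\<close> undoes the shift made by \<open>pos\<close> for even
    \<open>d\<close>. Beyond \<open>d div 2\<close> it is \<open>d div 2\<close> plus the absolute
    value of a negative label.\<close>
  define k where "k = r + (if even d then 1 else 0)"
  define a where "a = (if k \<le> d div 2 then int k else int (d div 2) - int k)"
  have "a \<in> labels d" "pos d a = r"
    using assms unfolding a_def k_def labels_def pos_def
    by (cases "even d"; auto elim!: evenE oddE)+
  then show thesis using that by blast
qed

lemma bij_betw_pos: "bij_betw (pos d) (labels d) {0..<d}"
proof -
  have "pos d ` labels d = {0..<d}"
    by (auto simp: pos_less) (metis imageI pos_surj)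
  then show ?thesis using inj_on_pos by (simp add: bij_betw_def)
qed

definition entry :: "nat \<Rightarrow> 'a mat \<Rightarrow> int \<Rightarrow> int \<Rightarrow> 'a" where
  "entry d X a b = X $$ (pos d a, pos d b)"

lemma mat_eqI_entry:
  assumes "X \<in> carrier_mat d d" "Y \<in> carrier_mat d d"
    and "\<And>a b. a \<in> labels d \<Longrightarrow> b \<in> labels d \<Longrightarrow> entry d X a b = entry d Y a b"
  shows "X = Y"
proof (rule eq_matI)
  fix r c assume "r < dim_row Y" "c < dim_col Y"
  then have "r < d" "c < d" using assms(2) by auto
  then obtain a b where "a \<in> labels d" "pos d a = r" "b \<in> labels d" "pos d b = c"
    by (metis pos_surj)
  then show "X $$ (r, c) = Y $$ (r, c)"
    using assms(3)[of a b] by (simp add: entry_def)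
qed (use assms in auto)

lemma entry_mult:
  fixes X Y :: "'a::semiring_0 mat"
  assumes "X \<in> carrier_mat d d" "Y \<in> carrier_mat d d" "a \<in> labels d" "b \<in> labels d"
  shows "entry d (X * Y) a b = (\<Sum>c\<in>labels d. entry d X a c * entry d Y c b)"
proof -
  have "entry d (X * Y) a b = (\<Sum>k\<in>{0..<d}. X $$ (pos d a, k) * Y $$ (k, pos d b))"
    using assms by (simp add: entry_def scalar_prod_def pos_less)
  also have "\<dots> = (\<Sum>c\<in>labels d. entry d X a c * entry d Y c b)"
    unfolding entry_def by (rule sum.reindex_bij_betw[OF bij_betw_pos, symmetric])
  finally show ?thesis .
qed

lemma entry_add:
  assumes "X \<in> carrier_mat d d" "Y \<in> carrier_mat d d" "a \<in> labels d" "b \<in> labels d"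
  shows "entry d (X + Y) a b = entry d X a b + entry d Y a b"
  using assms by (simp add: entry_def pos_less)

lemma entry_minus:
  assumes "X \<in> carrier_mat d d" "Y \<in> carrier_mat d d" "a \<in> labels d" "b \<in> labels d"
  shows "entry d (X - Y) a b = entry d X a b - entry d Y a b"
  using assms by (simp add: entry_def pos_less)

lemma entry_smult:
  assumes "X \<in> carrier_mat d d" "a \<in> labels d" "b \<in> labels d"
  shows "entry d (t \<cdot>\<^sub>m X) a b = t * entry d X a b"
  using assms by (simp add: entry_def pos_less)

lemma entry_one:
  assumes "a \<in> labels d" "b \<in> labels d"
  shows "entry d (1\<^sub>m d) a b = (if a = b then 1 else 0)"
  using assms by (simp add: entry_def pos_less pos_eq_iff)

lemma entry_munit:
  assumes "a \<in> labels d" "b \<in> labels d" "i \<in> labels d" "j \<in> labels d"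
  shows "entry d (munit d i j) a b = (if a = i \<and> b = j then 1 else 0)"
  using assms by (simp add: entry_def munit_def pos_less pos_eq_iff)

lemma munit_carrier [simp]: "munit d a b \<in> carrier_mat d d"
  by (simp add: munit_def)

lemma entry_diag:
  assumes "a \<in> labels d" "b \<in> labels d"
  shows "entry d (mat_diag d f) a b = (if a = b then f (pos d a) else 0)"
  using assms by (auto simp: entry_def mat_diag_def pos_less pos_eq_iff)

section \<open>The hermitian form in signed coordinates\<close>

definition weight :: "int \<Rightarrow> 'a::field" where
  "weight a = (if a = 0 then 2 else 1)"

lemma weight_uminus: "weight (- a) = weight a"
  by (simp add: weight_def)

lemma form_even_carrier: "form_even l \<in> carrier_mat (2 * l) (2 * l)"
  unfolding form_even_def mult_2 by (rule four_block_carrier_mat) auto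

lemma form_even_index:
  assumes "r < 2 * l" "c < 2 * l"
  shows "form_even l $$ (r, c) = (if c = r + l \<or> r = c + l then 1 else (0 :: 'a::field))"
  using assms unfolding form_even_def by (subst index_mat_four_block) auto

lemma form_mat_even: "form_mat (2 * l) = form_even l"
  by (simp add: form_mat_def)

lemma form_mat_odd:
  "form_mat (2 * l + 1) =
    four_block_mat (2 \<cdot>\<^sub>m 1\<^sub>m 1) (0\<^sub>m 1 (2 * l)) (0\<^sub>m (2 * l) 1) (form_even l)"
  by (simp add: form_mat_def)

lemma form_mat_carrier: "form_mat d \<in> carrier_mat d d"
proof (cases "even d")
  case True
  then obtain l where "d = 2 * l" ..
  then show ?thesis using form_even_carrier by (simp add: form_mat_even)
next
  case False
  then obtain l where d: "d = 2 * l + 1" ..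
  have "form_mat (2 * l + 1) \<in> carrier_mat (1 + 2 * l) (1 + 2 * l)"
    unfolding form_mat_odd by (rule four_block_carrier_mat) (auto simp: form_even_carrier)
  then show ?thesis unfolding d by (simp only: add.commute)
qed

text \<open>The identity blocks pair positions at distance l, and these carry the labels
  \<open>a\<close> and \<open>- a\<close>. For odd \<open>d\<close>, label 0 has a block of its own,
  where it is paired with itself with weight 2.\<close>

lemma entry_form:
  assumes "a \<in> labels d" "b \<in> labels d"
  shows "entry d (form_mat d) a b = (if b = - a then weight a else (0 :: 'a::field))"
proof (cases "even d")
  case True
  then obtain l where d: "d = 2 * l" ..
  have lt: "pos d a < 2 * l" "pos d b < 2 * l"
    using assms pos_less d by auto
  have "pos d b = pos d a + l \<or> pos d a = pos d b + l \<longleftrightarrow> b = - a"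
    using assms unfolding d labels_def pos_def by auto
  moreover have "a \<noteq> 0" using assms True by (simp add: labels_def)
  ultimately show ?thesis
    using form_even_index[OF lt, where 'a='a]
    unfolding entry_def weight_def d form_mat_even by (simp only: if_False)
next
  case False
  then obtain l where d: "d = 2 * l + 1" ..
  have lt: "pos d a < 1 + 2 * l" "pos d b < 1 + 2 * l"
    using pos_less[OF assms(1)] pos_less[OF assms(2)] d by simp_all
  have z: "pos d x = 0 \<longleftrightarrow> x = 0" if "x \<in> labels d" for x
    using that unfolding d labels_def pos_def by auto
  have opp: "pos d b - 1 = pos d a - 1 + l \<or> pos d a - 1 = pos d b - 1 + l \<longleftrightarrow> b = - a"
    if "a \<noteq> 0" "b \<noteq> 0"
    using assms that unfolding d labels_def pos_def by auto
  have dims: "dim_row (form_even l) = 2 * l" "dim_col (form_even l) = 2 * l"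
    using form_even_carrier[of l] by auto
  have "form_mat d $$ (pos d a, pos d b) =
    (if pos d a = 0 \<or> pos d b = 0 then if pos d a = pos d b then 2 else 0
     else form_even l $$ (pos d a - 1, pos d b - 1))"
    unfolding d form_mat_odd using lt[unfolded d]
    by (subst index_mat_four_block) (auto simp: dims)
  moreover have "form_even l $$ (pos d a - 1, pos d b - 1) = (if b = - a then 1 else (0 :: 'a))"
    if "a \<noteq> 0" "b \<noteq> 0"
  proof -
    have "pos d a > 0" "pos d b > 0"
      using that z assms by auto
    then have "pos d a - 1 < 2 * l" "pos d b - 1 < 2 * l"
      using lt by linarith+
    then show ?thesis using opp[OF that] by (simp add: form_even_index)
  qed
  ultimately show ?thesis
    using z[OF assms(1)] z[OF assms(2)] by (auto simp: entry_def weight_def)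
qed

text \<open>This is the sesquilinear form of \<open>form_mat d\<close>, conjugating the first
  argument. Vectors are functions on labels, so that row operations become maps between
  functions.\<close>

definition herm :: "nat \<Rightarrow> nat \<Rightarrow> (int \<Rightarrow> 'a::field) \<Rightarrow> (int \<Rightarrow> 'a) \<Rightarrow> 'a" where
  "herm d q f g = (\<Sum>r\<in>labels d. bar q (f r) * weight r * g (- r))"

definition unit_fun :: "int \<Rightarrow> int \<Rightarrow> 'a::field" where
  "unit_fun a r = (if r = a then 1 else 0)"

lemma entry_form_conj:
  fixes X :: "'a::field mat"
  assumes X: "X \<in> carrier_mat d d" and ab: "a \<in> labels d" "b \<in> labels d"
  shows "entry d (transpose_mat (map_mat (bar q) X) * form_mat d * X) a b =
    herm d q (\<lambda>r. entry d X r a) (\<lambda>r. entry d X r b)"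
proof -
  let ?T = "transpose_mat (map_mat (bar q) X)"
  have T: "?T \<in> carrier_mat d d" using X by simp
  have eT: "entry d ?T a c = bar q (entry d X c a)" if "c \<in> labels d" for c
    using X ab that by (simp add: entry_def pos_less)
  have TF: "entry d (?T * form_mat d) a c = bar q (entry d X (- c) a) * weight c"
    if c: "c \<in> labels d" for c
  proof -
    have "entry d (?T * form_mat d) a c =
      (\<Sum>r\<in>labels d. bar q (entry d X r a) * (if c = - r then weight r else 0))"
      unfolding entry_mult[OF T form_mat_carrier ab(1) c]
      by (rule sum.cong) (simp_all add: eT entry_form c)
    also have "\<dots> = (\<Sum>r\<in>labels d. if r = - c then bar q (entry d X r a) * weight r else 0)"
      by (rule sum.cong) auto
    also have "\<dots> = bar q (entry d X (- c) a) * weight c"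
      using c by (simp add: sum.delta finite_labels weight_uminus)
    finally show ?thesis .
  qed
  have "entry d (?T * form_mat d * X) a b =
    (\<Sum>c\<in>labels d. bar q (entry d X (- c) a) * weight c * entry d X c b)"
    unfolding entry_mult[OF mult_carrier_mat[OF T form_mat_carrier] X ab]
    by (rule sum.cong) (simp_all add: TF)
  also have "\<dots> = herm d q (\<lambda>r. entry d X r a) (\<lambda>r. entry d X r b)"
    unfolding herm_def
    by (rule sum.reindex_bij_witness[of _ uminus uminus]) (auto simp: weight_uminus)
  finally show ?thesis .
qed

section \<open>The general linear group and its unitary subgroup\<close>

lemma GL_carrier: "carrier (GL TYPE('a::field) d) = Units (ring_mat TYPE('a) d ())"
  by (rule units_of_carrier)

lemma GL_mult [simp]: "x \<otimes>\<^bsub>GL TYPE('a::field) d\<^esub> y = x * y"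
  by (simp add: units_of_mult ring_mat_def)

lemma GL_one [simp]: "\<one>\<^bsub>GL TYPE('a::field) d\<^esub> = 1\<^sub>m d"
  by (simp add: units_of_one ring_mat_def)

lemma GL_group: "group (GL TYPE('a::field) d)"
proof -
  interpret ring "ring_mat TYPE('a) d ()" by (rule ring_mat)
  show ?thesis by (rule units_group)
qed

lemma GL_carrier_mat: "X \<in> carrier (GL TYPE('a::field) d) \<Longrightarrow> X \<in> carrier_mat d d"
  unfolding GL_carrier by (auto simp: Units_def ring_mat_def)

context finite_unitary
begin

lemma weight_nonzero: "a \<in> labels d \<Longrightarrow> weight a \<noteq> (0 :: 'a)"
  using two_nonzero by (auto simp: weight_def labels_def)

lemma herm_unit_left:
  assumes "a \<in> labels d"
  shows "herm d q (unit_fun a) g = weight a * (g (- a) :: 'a)"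
proof -
  have "herm d q (unit_fun a) g = (\<Sum>r\<in>labels d. if r = a then weight a * g (- a) else 0)"
    unfolding herm_def unit_fun_def by (rule sum.cong) (auto simp: bar_0 bar_1)
  then show ?thesis using assms by (simp add: finite_labels)
qed

lemma herm_cong:
  assumes "\<And>r. r \<in> labels d \<Longrightarrow> f r = f' r" "\<And>r. r \<in> labels d \<Longrightarrow> g r = g' r"
  shows "herm d q f g = herm d q f' (g' :: int \<Rightarrow> 'a)"
  unfolding herm_def using assms by (auto intro!: sum.cong)

text \<open>Multiplying by \<open>F\<close> divides each row of the form matrix by its weight. What
  remains is the permutation matrix of negation on labels, whose square is the identity.\<close>

lemma form_det_nonzero: "det (form_mat d :: 'a mat) \<noteq> 0"
proof -
  define F where "F = mat_diag d (\<lambda>r. if r = pos d 0 \<and> odd d then inverse 2 else 1 :: 'a)"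
  define G where "G = form_mat d * (F * form_mat d)"
  have F: "F \<in> carrier_mat d d" by (simp add: F_def)
  have eF: "entry d F a b = (if a = b then inverse (weight a) else 0)"
    if "a \<in> labels d" "b \<in> labels d" for a b
  proof -
    have "pos d a = pos d 0 \<longleftrightarrow> a = 0" if "odd d"
      using pos_eq_iff[of a d 0] \<open>a \<in> labels d\<close> that by (simp add: labels_def)
    then show ?thesis
      using that unfolding F_def by (auto simp: entry_diag weight_def labels_def)
  qed
  have *: "entry d (F * form_mat d) a b = (if b = - a then 1 else 0)"
    if ab: "a \<in> labels d" "b \<in> labels d" for a b
  proof -
    have "entry d (F * form_mat d) a b =
      (\<Sum>r\<in>labels d. if r = a then (if b = - a then 1 else 0) else 0)"
      unfolding entry_mult[OF F form_mat_carrier ab]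
      by (rule sum.cong) (auto simp: eF entry_form ab weight_nonzero)
    then show ?thesis using ab by (simp add: finite_labels)
  qed
  have FF: "F * form_mat d \<in> carrier_mat d d"
    using F form_mat_carrier by (rule mult_carrier_mat)
  have G: "(F * form_mat d) * (F * form_mat d) = 1\<^sub>m d"
  proof (rule mat_eqI_entry)
    fix a b assume ab: "a \<in> labels d" "b \<in> labels d"
    have "entry d ((F * form_mat d) * (F * form_mat d)) a b =
      (\<Sum>r\<in>labels d. if r = - a then (if b = a then 1 else 0) else 0)"
      unfolding entry_mult[OF FF FF ab]
      by (rule sum.cong) (auto simp: * ab)
    then show "entry d ((F * form_mat d) * (F * form_mat d)) a b = entry d (1\<^sub>m d) a b"
      using ab by (simp add: finite_labels entry_one)
  qed (use FF in auto)
  have "det (F * form_mat d) * det (F * form_mat d) = 1"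
    unfolding det_mult[OF FF FF, symmetric] G by simp
  then have "det F * det (form_mat d :: 'a mat) \<noteq> 0"
    unfolding det_mult[OF F form_mat_carrier] by auto
  then show ?thesis by simp
qed

lemma unitary_carrier: "X \<in> unitary d q \<Longrightarrow> X \<in> carrier_mat d d"
  by (simp add: unitary_def GL_carrier_mat)

text \<open>Membership in GL is automatic: the form matrix has nonzero determinant, so a matrix
  preserving it has nonzero determinant as well. The rest compares the Gram matrix of the columns
  with that of the standard basis.\<close>

lemma unitary_iff:
  "X \<in> unitary d q \<longleftrightarrow> X \<in> carrier_mat d d \<and>
    (\<forall>a\<in>labels d. \<forall>b\<in>labels d. herm d q (\<lambda>r. entry d X r a) (\<lambda>r. entry d X r b) =
      (if b = - a then weight a else (0 :: 'a)))"
  (is "_ \<longleftrightarrow> _ \<and> ?C")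
proof (cases "X \<in> carrier_mat d d")
  case X: True
  let ?T = "transpose_mat (map_mat (bar q) X)"
  have T: "?T \<in> carrier_mat d d" using X by simp
  have TF: "?T * form_mat d \<in> carrier_mat d d"
    using T form_mat_carrier by (rule mult_carrier_mat)
  have eq: "?T * form_mat d * X = form_mat d \<longleftrightarrow> ?C"
  proof
    assume "?T * form_mat d * X = form_mat d"
    then show ?C
      using entry_form_conj[OF X] entry_form[where 'a='a] by metis
  next
    assume C: ?C
    show "?T * form_mat d * X = form_mat d"
      by (rule mat_eqI_entry[OF mult_carrier_mat[OF TF X] form_mat_carrier])
        (use C in \<open>simp add: entry_form_conj[OF X] entry_form\<close>)
  qed
  have "X \<in> carrier (GL TYPE('a) d)" if "?T * form_mat d * X = form_mat d"
  proof -
    have "det (?T * form_mat d) * det X \<noteq> 0"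
      unfolding det_mult[OF TF X, symmetric] that by (rule form_det_nonzero)
    then show ?thesis
      unfolding GL_carrier using det_non_zero_imp_unit[OF X] by auto
  qed
  then show ?thesis
    using X eq by (auto simp: unitary_def)
qed (use unitary_carrier in blast)

lemma one_unitary: "(1\<^sub>m d :: 'a mat) \<in> unitary d q"
  unfolding unitary_iff
proof (intro conjI ballI)
  fix a b assume ab: "a \<in> labels d" "b \<in> labels d"
  have "herm d q (\<lambda>r. entry d (1\<^sub>m d) r a) (\<lambda>r. entry d (1\<^sub>m d) r b) =
    herm d q (unit_fun a) (unit_fun b :: int \<Rightarrow> 'a)"
    by (rule herm_cong) (use ab in \<open>auto simp: entry_one unit_fun_def\<close>)
  then show "herm d q (\<lambda>r. entry d (1\<^sub>m d) r a) (\<lambda>r. entry d (1\<^sub>m d) r b) =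
      (if b = - a then weight a else (0 :: 'a))"
    using ab by (auto simp: herm_unit_left unit_fun_def)
qed simp

lemma unitary_subgroup: "subgroup (unitary d q) (GL TYPE('a) d)"
proof -
  interpret group "GL TYPE('a) d" by (rule GL_group)
  \<comment> \<open>\<open>conj\<close> is a right action of matrices on forms, and the unitary
    matrices are the stabilizer of \<open>form_mat d\<close>. This yields closure under products and
    inverses.\<close>
  define conj :: "'a mat \<Rightarrow> 'a mat \<Rightarrow> 'a mat"
    where "conj F X = transpose_mat (map_mat (bar q) X) * F * X" for F X
  have unitary: "X \<in> unitary d q \<longleftrightarrow>
      X \<in> carrier (GL TYPE('a) d) \<and> conj (form_mat d) X = form_mat d" for X
    by (simp add: unitary_def conj_def)
  have bar_mat_mult: "map_mat (bar q) (X * Y) = map_mat (bar q) X * map_mat (bar q) Y"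
    if "X \<in> carrier_mat d d" "Y \<in> carrier_mat d d" for X Y :: "'a mat"
  proof -
    have sum: "bar q (sum f A) = (\<Sum>x\<in>A. bar q (f x))" for f :: "nat \<Rightarrow> 'a" and A
      by (induction A rule: infinite_finite_induct) (auto simp: bar_0 bar_add)
    show ?thesis
      by (rule eq_matI) (use that in \<open>auto simp: scalar_prod_def sum bar_mult\<close>)
  qed
  have conj_mult: "conj F (X * Y) = conj (conj F X) Y"
    if c: "F \<in> carrier_mat d d" "X \<in> carrier_mat d d" "Y \<in> carrier_mat d d" for F X Y
  proof -
    let ?X = "transpose_mat (map_mat (bar q) X)" and ?Y = "transpose_mat (map_mat (bar q) Y)"
    have cX: "?X \<in> carrier_mat d d" and cY: "?Y \<in> carrier_mat d d"
      using c by auto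
    have "transpose_mat (map_mat (bar q) (X * Y)) = ?Y * ?X"
      unfolding bar_mat_mult[OF c(2,3)] by (rule transpose_mult) (use c in auto)
    then show ?thesis
      using c cX cY by (simp add: conj_def assoc_mult_mat[of _ d d _ d _ d])
  qed
  note c = GL_carrier_mat form_mat_carrier[of d, where 'a='a]
  show ?thesis
  proof (rule subgroupI)
    show "unitary d q \<subseteq> carrier (GL TYPE('a) d)"
      by (auto simp: unitary_def)
    show "unitary d q \<noteq> ({} :: 'a mat set)"
      using one_unitary by blast
  next
    fix X Y :: "'a mat" assume "X \<in> unitary d q" "Y \<in> unitary d q"
    then show "X \<otimes>\<^bsub>GL TYPE('a) d\<^esub> Y \<in> unitary d q"
      using m_closed[of X Y] by (simp add: unitary conj_mult c)
  next
    fix X :: "'a mat" assume X: "X \<in> unitary d q"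
    let ?Y = "inv\<^bsub>GL TYPE('a) d\<^esub> X"
    have XG: "X \<in> carrier (GL TYPE('a) d)" using X by (simp add: unitary)
    have "X * ?Y = 1\<^sub>m d"
      using r_inv[OF XG] by simp
    then have "conj (conj (form_mat d) X) ?Y = form_mat d"
      using conj_mult[of "form_mat d" X ?Y] one_unitary inv_closed[OF XG] XG
      by (simp add: unitary c)
    then show "?Y \<in> unitary d q"
      using X inv_closed[OF XG] by (simp add: unitary)
  qed
qed

end

section \<open>Row operations\<close>

text \<open>The effect of an elementary matrix on a single column; all rows are updated at once from
  the old column. \<open>short_op\<close>, \<open>long_op\<close> and \<open>odd_op\<close> belong
  to \<open>short_mat\<close>, \<open>long_mat\<close> and \<open>odd_mat\<close>.\<close>

definition short_op :: "nat \<Rightarrow> int \<Rightarrow> int \<Rightarrow> 'a::field \<Rightarrow> (int \<Rightarrow> 'a) \<Rightarrow> int \<Rightarrow> 'a" where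
  "short_op q a b t f r =
    f r + (if r = a then t * f b else 0) - (if r = - b then bar q t * f (- a) else 0)"

definition long_op :: "int \<Rightarrow> 'a::field \<Rightarrow> (int \<Rightarrow> 'a) \<Rightarrow> int \<Rightarrow> 'a" where
  "long_op a s f r = f r + (if r = a then s * f (- a) else 0)"

definition odd_op :: "nat \<Rightarrow> int \<Rightarrow> 'a::field \<Rightarrow> (int \<Rightarrow> 'a) \<Rightarrow> int \<Rightarrow> 'a" where
  "odd_op q a t f r =
    f r - (if r = a then 2 * bar q t * f 0 else 0) + (if r = 0 then t * f (- a) else 0)
      - (if r = a then t * bar q t * f (- a) else 0)"

text \<open>
  Admitting signed labels merges the families of elementary matrices: for \<open>a \<noteq> \<plusminus>b\<close> nonzero,
  \<open>short_mat d q a b t\<close> is \<open>x\<^sub>a\<^sub>,\<^sub>b(t)\<close> or, if that is not listed, \<open>x\<^sub>-\<^sub>b\<^sub>,\<^sub>-\<^sub>a(-bar q t)\<close>, and for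
  \<open>i > 0\<close> the matrices \<open>odd_mat d q i t\<close> and \<open>odd_mat d q (-i) t\<close> are \<open>x\<^sub>i\<^sub>,\<^sub>0(t)\<close> and \<open>x\<^sub>0\<^sub>,\<^sub>i(t)\<close>.
\<close>

definition short_mat :: "nat \<Rightarrow> nat \<Rightarrow> int \<Rightarrow> int \<Rightarrow> 'a::field \<Rightarrow> 'a mat" where
  "short_mat d q a b t = 1\<^sub>m d + t \<cdot>\<^sub>m munit d a b - bar q t \<cdot>\<^sub>m munit d (- b) (- a)"

definition long_mat :: "nat \<Rightarrow> int \<Rightarrow> 'a::field \<Rightarrow> 'a mat" where
  "long_mat d a s = 1\<^sub>m d + s \<cdot>\<^sub>m munit d a (- a)"

definition odd_mat :: "nat \<Rightarrow> nat \<Rightarrow> int \<Rightarrow> 'a::field \<Rightarrow> 'a mat" where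
  "odd_mat d q a t = 1\<^sub>m d - (2 * bar q t) \<cdot>\<^sub>m munit d a 0 + t \<cdot>\<^sub>m munit d 0 (- a)
      - (t * bar q t) \<cdot>\<^sub>m munit d a (- a)"

section \<open>Left multiplication as a row operation\<close>

lemma row_op_mat_carrier [simp]:
  "short_mat d q a b t \<in> carrier_mat d d"
  "long_mat d a s \<in> carrier_mat d d"
  "odd_mat d q a t \<in> carrier_mat d d"
  unfolding short_mat_def long_mat_def odd_mat_def
  by (intro minus_carrier_mat add_carrier_mat smult_carrier_mat munit_carrier)+

lemma entry_munit_mult:
  fixes X :: "'a::field mat"
  assumes X: "X \<in> carrier_mat d d" and rc: "r \<in> labels d" "c \<in> labels d"
    and ij: "i \<in> labels d" "j \<in> labels d"
  shows "entry d (munit d i j * X) r c = (if r = i then entry d X j c else 0)"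
proof -
  have "entry d (munit d i j * X) r c =
    (\<Sum>k\<in>labels d. if k = j then (if r = i then entry d X j c else 0) else 0)"
    unfolding entry_mult[OF munit_carrier X rc]
    by (rule sum.cong) (auto simp: entry_munit rc ij)
  then show ?thesis using ij by (simp add: finite_labels)
qed

text \<open>\<open>M\<close> is arbitrary so that rewriting can peel off one matrix unit at a time
  until only the identity is left.\<close>

lemma entry_one_plus_mult:
  fixes X :: "'a::field mat"
  assumes M: "M \<in> carrier_mat d d" and X: "X \<in> carrier_mat d d"
    and rc: "r \<in> labels d" "c \<in> labels d" and ij: "i \<in> labels d" "j \<in> labels d"
  shows "entry d ((M + t \<cdot>\<^sub>m munit d i j) * X) r c =
      entry d (M * X) r c + (if r = i then t * entry d X j c else 0)"
    and "entry d ((M - t \<cdot>\<^sub>m munit d i j) * X) r c =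
      entry d (M * X) r c - (if r = i then t * entry d X j c else 0)"
proof -
  have c: "t \<cdot>\<^sub>m munit d i j \<in> carrier_mat d d" by simp
  have "entry d (t \<cdot>\<^sub>m munit d i j * X) r c = t * entry d (munit d i j * X) r c"
    unfolding mult_smult_assoc_mat[OF munit_carrier X]
    by (rule entry_smult[OF mult_carrier_mat[OF munit_carrier X] rc])
  then have e: "entry d (t \<cdot>\<^sub>m munit d i j * X) r c = (if r = i then t * entry d X j c else 0)"
    by (simp add: entry_munit_mult[OF X rc ij])
  show "entry d ((M + t \<cdot>\<^sub>m munit d i j) * X) r c =
      entry d (M * X) r c + (if r = i then t * entry d X j c else 0)"
    unfolding add_mult_distrib_mat[OF M c X] e[symmetric]
    by (rule entry_add[OF mult_carrier_mat[OF M X] mult_carrier_mat[OF c X] rc])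
  show "entry d ((M - t \<cdot>\<^sub>m munit d i j) * X) r c =
      entry d (M * X) r c - (if r = i then t * entry d X j c else 0)"
    unfolding minus_mult_distrib_mat[OF M c X] e[symmetric]
    by (rule entry_minus[OF mult_carrier_mat[OF M X] mult_carrier_mat[OF c X] rc])
qed

lemma entry_short_mat:
  fixes X :: "'a::field mat"
  assumes X: "X \<in> carrier_mat d d" and "r \<in> labels d" "c \<in> labels d" "a \<in> labels d" "b \<in> labels d"
  shows "entry d (short_mat d q a b t * X) r c = short_op q a b t (\<lambda>r. entry d X r c) r"
  using assms left_mult_one_mat[OF X]
  by (simp add: short_mat_def short_op_def entry_one_plus_mult)

lemma entry_long_mat:
  fixes X :: "'a::field mat"
  assumes X: "X \<in> carrier_mat d d" and "r \<in> labels d" "c \<in> labels d" "a \<in> labels d"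
  shows "entry d (long_mat d a t * X) r c = long_op a t (\<lambda>r. entry d X r c) r"
  using assms left_mult_one_mat[OF X]
  by (simp add: long_mat_def long_op_def entry_one_plus_mult)

lemma entry_odd_mat:
  fixes X :: "'a::field mat"
  assumes X: "X \<in> carrier_mat d d" and "r \<in> labels d" "c \<in> labels d" "a \<in> labels d" "0 \<in> labels d"
  shows "entry d (odd_mat d q a t * X) r c = odd_op q a t (\<lambda>r. entry d X r c) r"
  using assms left_mult_one_mat[OF X]
  by (simp add: odd_mat_def odd_op_def entry_one_plus_mult minus_carrier_mat)

lemma entry_diag_mult:
  fixes X :: "'a::field mat"
  assumes X: "X \<in> carrier_mat d d" and rc: "r \<in> labels d" "c \<in> labels d"
  shows "entry d (mat_diag d f * X) r c = f (pos d r) * entry d X r c"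
  using assms by (simp add: mat_diag_mult_left[OF X] entry_def pos_less)

text \<open>To check invariance of the form, only the few labels touched by an operation matter.
  Summand r involves \<open>g (- r)\<close>, so \<open>S\<close> is chosen closed under
  negation.\<close>

lemma herm_diff_support:
  assumes "S \<subseteq> labels d" "\<And>r. r \<notin> S \<Longrightarrow> f' r = f r" "\<And>r. r \<notin> S \<Longrightarrow> g' (- r) = g (- r)"
    and "(\<Sum>r\<in>S. bar q (f' r) * weight r * g' (- r)) = (\<Sum>r\<in>S. bar q (f r) * weight r * g (- r))"
  shows "herm d q f' g' = herm d q f (g :: int \<Rightarrow> 'a::field)"
proof -
  have split: "herm d q u v = (\<Sum>r\<in>labels d - S. bar q (u r) * weight r * v (- r)) +
      (\<Sum>r\<in>S. bar q (u r) * weight r * v (- r))" for u v :: "int \<Rightarrow> 'a"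
    unfolding herm_def by (rule sum.subset_diff[OF assms(1) finite_labels])
  have "(\<Sum>r\<in>labels d - S. bar q (f' r) * weight r * g' (- r)) =
      (\<Sum>r\<in>labels d - S. bar q (f r) * weight r * g (- r))"
    by (rule sum.cong) (use assms in auto)
  then show ?thesis unfolding split using assms(4) by simp
qed

section \<open>Invariance of the form under row operations\<close>

context finite_unitary
begin

lemmas bar_simps = bar_add bar_diff bar_minus bar_mult bar_0 bar_1 bar_2 bar_bar

text \<open>The change in row \<open>a\<close> paired with row \<open>- a\<close> cancels that in
  row \<open>- b\<close> paired with row \<open>b\<close>. The hypotheses on the labels keep changed
  rows from being paired with each other.\<close>

lemma herm_short_op:
  assumes "a \<in> labels d" "b \<in> labels d" "a \<noteq> 0" "b \<noteq> 0" "a \<noteq> b" "a \<noteq> - b"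
  shows "herm d q (short_op q a b t f) (short_op q a b t g) = herm d q f (g :: int \<Rightarrow> 'a)"
proof (rule herm_diff_support[of "{a, - a, b, - b}"])
  have "b \<noteq> - a" "- a \<noteq> b" "- a \<noteq> a" "- b \<noteq> b" "a \<noteq> - a" "b \<noteq> - b" "- b \<noteq> a" using assms by auto
  with assms show "(\<Sum>r\<in>{a, - a, b, - b}. bar q (short_op q a b t f r) * weight r * short_op q a b t g (- r)) =
      (\<Sum>r\<in>{a, - a, b, - b}. bar q (f r) * weight r * g (- r))"
    by (simp add: short_op_def weight_def bar_simps algebra_simps)
qed (use assms in \<open>auto simp: short_op_def\<close>)

text \<open>The form changes by s + \<open>bar q s\<close> times a product of the entries in row
  \<open>- a\<close>, and this factor is 0 for skew s.\<close>

lemma herm_long_op: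
  assumes "a \<in> labels d" "a \<noteq> 0" "s \<in> skew_elems q"
  shows "herm d q (long_op a s f) (long_op a s g) = herm d q f (g :: int \<Rightarrow> 'a)"
proof (rule herm_diff_support[of "{a, - a}"])
  have "- a \<noteq> a" "a \<noteq> - a" using assms by auto
  with assms show "(\<Sum>r\<in>{a, - a}. bar q (long_op a s f r) * weight r * long_op a s g (- r)) =
      (\<Sum>r\<in>{a, - a}. bar q (f r) * weight r * g (- r))"
    by (simp add: long_op_def weight_def bar_simps algebra_simps skew_elems_def)
qed (use assms in \<open>auto simp: long_op_def\<close>)

text \<open>The coefficient 2 in row \<open>a\<close> balances the weight 2 of label 0. The products
  \<open>t * bar q t\<close> arising from rows \<open>a\<close> and \<open>- a\<close> together
  cancel the doubled one from label 0.\<close>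

lemma herm_odd_op:
  assumes "a \<in> labels d" "0 \<in> labels d" "a \<noteq> 0"
  shows "herm d q (odd_op q a t f) (odd_op q a t g) = herm d q f (g :: int \<Rightarrow> 'a)"
proof (rule herm_diff_support[of "{0, a, - a}"])
  have "- a \<noteq> a" "a \<noteq> - a" "0 \<noteq> a" "0 \<noteq> - a" using assms by auto
  with assms show "(\<Sum>r\<in>{0, a, - a}. bar q (odd_op q a t f r) * weight r * odd_op q a t g (- r)) =
      (\<Sum>r\<in>{0, a, - a}. bar q (f r) * weight r * g (- r))"
    by (simp add: odd_op_def weight_def bar_simps algebra_simps)
qed (use assms in \<open>auto simp: odd_op_def\<close>)

text \<open>The columns of \<open>M\<close> are the images under \<open>T\<close> of the standard
  basis, and an isometry keeps their Gram matrix.\<close>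

lemma unitary_if_row_op:
  assumes M: "M \<in> carrier_mat d d"
    and row_op: "\<And>r c. r \<in> labels d \<Longrightarrow> c \<in> labels d \<Longrightarrow>
      entry d M r c = T (\<lambda>r. entry d (1\<^sub>m d) r c) r"
    and herm: "\<And>f g. herm d q (T f) (T g) = herm d q f (g :: int \<Rightarrow> 'a)"
  shows "M \<in> unitary d q"
  unfolding unitary_iff
proof (intro conjI ballI)
  fix a b assume ab: "a \<in> labels d" "b \<in> labels d"
  have "herm d q (\<lambda>r. entry d M r a) (\<lambda>r. entry d M r b) =
      herm d q (T (\<lambda>r. entry d (1\<^sub>m d) r a)) (T (\<lambda>r. entry d (1\<^sub>m d) r b))"
    by (rule herm_cong) (simp_all add: row_op ab)
  then show "herm d q (\<lambda>r. entry d M r a) (\<lambda>r. entry d M r b) =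
      (if b = - a then weight a else 0)"
    unfolding herm using one_unitary ab by (simp add: unitary_iff)
qed (rule M)

lemma short_mat_unitary:
  assumes "a \<in> labels d" "b \<in> labels d" "a \<noteq> 0" "b \<noteq> 0" "a \<noteq> b" "a \<noteq> - b"
  shows "short_mat d q a b (t :: 'a) \<in> unitary d q"
  by (rule unitary_if_row_op[OF _ _ herm_short_op[OF assms, where t = t]])
    (use assms in \<open>simp_all add: entry_short_mat[OF one_carrier_mat, symmetric]
        right_mult_one_mat[OF row_op_mat_carrier(1)]\<close>)

lemma long_mat_unitary:
  assumes "a \<in> labels d" "a \<noteq> 0" "s \<in> skew_elems q"
  shows "long_mat d a (s :: 'a) \<in> unitary d q"
  by (rule unitary_if_row_op[OF _ _ herm_long_op[OF assms]])
    (use assms in \<open>simp_all add: entry_long_mat[OF one_carrier_mat, symmetric]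
        right_mult_one_mat[OF row_op_mat_carrier(2)]\<close>)

lemma odd_mat_unitary:
  assumes "a \<in> labels d" "0 \<in> labels d" "a \<noteq> 0"
  shows "odd_mat d q a (t :: 'a) \<in> unitary d q"
  by (rule unitary_if_row_op[OF _ _ herm_odd_op[OF assms, where t = t]])
    (use assms in \<open>simp_all add: entry_odd_mat[OF one_carrier_mat, symmetric]
        right_mult_one_mat[OF row_op_mat_carrier(3)]\<close>)

lemma mat_diag_unitary:
  assumes "\<And>r. r \<in> labels d \<Longrightarrow> bar q (f (pos d r)) * f (pos d (- r)) = (1 :: 'a)"
  shows "mat_diag d f \<in> unitary d q"
proof (rule unitary_if_row_op)
  fix u v :: "int \<Rightarrow> 'a"
  show "herm d q (\<lambda>r. f (pos d r) * u r) (\<lambda>r. f (pos d r) * v r) = herm d q u v"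
    unfolding herm_def
  proof (rule sum.cong)
    fix r assume "r \<in> labels d"
    then have "bar q (f (pos d r)) * f (pos d (- r)) * (bar q (u r) * weight r * v (- r)) =
        bar q (u r) * weight r * v (- r)"
      using assms by simp
    then show "bar q (f (pos d r) * u r) * weight r * (f (pos d (- r)) * v (- r)) =
        bar q (u r) * weight r * v (- r)"
      by (simp add: bar_mult mult_ac)
  qed simp
qed (auto simp: entry_diag entry_one)

lemma h_last_unitary: "z \<noteq> 0 \<Longrightarrow> h_last d q (z :: 'a) \<in> unitary d q"
proof -
  assume z: "z \<noteq> 0"
  let ?l = "int (d div 2)"
  have l: "?l \<in> labels d" "?l \<noteq> 0" using d_ge by (auto simp: labels_def)
  show ?thesis
    unfolding h_last_def Let_def
    by (rule mat_diag_unitary)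
      (use z l in \<open>auto simp: pos_eq_iff bar_inverse bar_bar bar_1 bar_eq_0\<close>)
qed

lemma h_zero_unitary:
  assumes "0 \<in> labels d" "z * bar q z = (1 :: 'a)"
  shows "h_zero d z \<in> unitary d q"
  unfolding h_zero_def
  by (rule mat_diag_unitary) (use assms in \<open>auto simp: pos_eq_iff bar_1 mult.commute\<close>)

section \<open>Elementary matrices with signed labels\<close>

lemma short_mat_swap: "short_mat d q a b t = short_mat d q (- b) (- a) (- bar q t :: 'a)"
  by (rule eq_matI) (auto simp: short_mat_def munit_def bar_minus bar_bar)

lemma short_mat_elementary:
  assumes "a \<in> labels d" "b \<in> labels d" "a \<noteq> 0" "b \<noteq> 0" "a \<noteq> b" "a \<noteq> - b"
  shows "short_mat d q a b (t :: 'a) \<in> elementary d q"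
proof -
  let ?I = "{1..int (d div 2)}"
  have abs: "\<bar>a\<bar> \<in> ?I" "\<bar>b\<bar> \<in> ?I" using assms by (auto simp: labels_def)
  \<comment> \<open>In the second, fourth and sixth case the matrix is listed with its two matrix
    units in the other order, so \<open>short_mat_swap\<close> is applied first.\<close>
  consider "a > 0" "b > 0" | "a < 0" "b < 0" | "a > 0" "b < 0" "a < - b" | "a > 0" "b < 0" "- b < a"
    | "a < 0" "b > 0" "- a < b" | "a < 0" "b > 0" "b < - a"
    using assms by linarith
  then show ?thesis
  proof cases
    case 1
    then show ?thesis using elementary.pos_pos[of a d b t q] abs assms by (simp add: short_mat_def)
  next
    case 2
    then show ?thesis
      unfolding short_mat_swap[of a b t] unfolding short_mat_def
      using elementary.pos_pos[of "- b" d "- a" "- bar q t" q] abs assms by simp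
  next
    case 3
    then show ?thesis using elementary.pos_neg[of a d "- b" t q] abs by (simp add: short_mat_def)
  next
    case 4
    then show ?thesis
      unfolding short_mat_swap[of a b t] unfolding short_mat_def
      using elementary.pos_neg[of "- b" d a "- bar q t" q] abs by simp
  next
    case 5
    then show ?thesis using elementary.neg_pos[of "- a" d b t q] abs by (simp add: short_mat_def)
  next
    case 6
    then show ?thesis
      unfolding short_mat_swap[of a b t] unfolding short_mat_def
      using elementary.neg_pos[of b d "- a" "- bar q t" q] abs by simp
  qed
qed

lemma long_mat_elementary:
  assumes "a \<in> labels d" "a \<noteq> 0" "s \<in> skew_elems q"
  shows "long_mat d a (s :: 'a) \<in> elementary d q"
proof (cases "a > 0")
  case True
  then show ?thesis
    using elementary.long_pos[of a d s q] assms by (simp add: long_mat_def labels_def)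
next
  case False
  then show ?thesis
    using elementary.long_neg[of "- a" d s q] assms by (simp add: long_mat_def labels_def)
qed

text \<open>This is the order of summands in the rule \<open>odd_neg\<close>;
  \<open>odd_mat_def\<close> follows \<open>odd_pos\<close>.\<close>

lemma odd_mat_alt:
  "odd_mat d q a t = 1\<^sub>m d + t \<cdot>\<^sub>m munit d 0 (- a) - (2 * bar q t) \<cdot>\<^sub>m munit d a 0
      - (t * bar q t) \<cdot>\<^sub>m munit d a (- a)"
  by (rule eq_matI) (auto simp: odd_mat_def munit_def)

lemma odd_mat_elementary:
  assumes "a \<in> labels d" "0 \<in> labels d" "a \<noteq> 0"
  shows "odd_mat d q a (t :: 'a) \<in> elementary d q"
proof (cases "a > 0")
  case True
  then show ?thesis
    using elementary.odd_pos[of d a q t] assms by (simp add: odd_mat_def labels_def)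
next
  case False
  then show ?thesis
    using elementary.odd_neg[of d "- a" t q] assms by (simp add: odd_mat_alt labels_def)
qed

lemma elementary_subset_unitary: "elementary d q \<subseteq> (unitary d q :: 'a mat set)"
proof
  fix M :: "'a mat" assume "M \<in> elementary d q"
  then show "M \<in> unitary d q"
  proof cases
    case (pos_pos i j t)
    then show ?thesis
      using short_mat_unitary[of i j t] by (simp add: short_mat_def labels_def)
  next
    case (pos_neg i j t)
    then show ?thesis
      using short_mat_unitary[of i "- j" t] by (simp add: short_mat_def labels_def)
  next
    case (neg_pos i j t)
    then show ?thesis
      using short_mat_unitary[of "- i" j t] by (simp add: short_mat_def labels_def)
  next
    case (long_pos i s)
    then show ?thesis
      using long_mat_unitary[of i s] by (simp add: long_mat_def labels_def)
  next
    case (long_neg i s)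
    then show ?thesis
      using long_mat_unitary[of "- i" s] by (simp add: long_mat_def labels_def)
  next
    case (odd_pos i t)
    then show ?thesis
      using odd_mat_unitary[of i t] by (simp add: odd_mat_def labels_def)
  next
    case (odd_neg i t)
    then show ?thesis
      using odd_mat_unitary[of "- i" t] by (simp add: odd_mat_alt labels_def)
  qed
qed

end

section \<open>Elimination\<close>

context finite_unitary
begin

text \<open>One set covers both parities of \<open>d\<close>, so that the elimination is carried out
  only once.\<close>

definition gens :: "'a mat set" where
  "gens = elementary d q \<union> {h_last d q \<zeta>} \<union>
    (if odd d then {h_zero d (\<zeta> ^ (q - 1))} else {})"

definition gen_grp :: "'a mat set" where
  "gen_grp = generate (GL TYPE('a) d) gens"

lemma zero_label: "0 \<in> labels d \<longleftrightarrow> odd d"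
  by (simp add: labels_def)

lemma gens_subset_unitary: "gens \<subseteq> unitary d q"
proof -
  have "\<zeta> ^ (q - 1) * bar q (\<zeta> ^ (q - 1)) = 1"
    using norm_one_group rangeI[of "\<lambda>k::int. (\<zeta> ^ (q - 1)) powi k" 1] by simp
  then show ?thesis
    unfolding gens_def
    using elementary_subset_unitary h_last_unitary[OF zeta_nonzero] h_zero_unitary zero_label
    by auto
qed

lemma gen_grp_subset_unitary: "gen_grp \<subseteq> unitary d q"
  unfolding gen_grp_def
  by (rule group.generate_subgroup_incl[OF GL_group gens_subset_unitary unitary_subgroup])

lemma elementary_in_gen_grp: "M \<in> elementary d q \<Longrightarrow> M \<in> gen_grp"
  unfolding gen_grp_def gens_def by (blast intro: generate.incl)

lemma one_in_gen_grp: "1\<^sub>m d \<in> gen_grp"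
  using generate.one[of "GL TYPE('a) d" gens] by (simp add: gen_grp_def)

lemma mult_in_gen_grp: "M \<in> gen_grp \<Longrightarrow> N \<in> gen_grp \<Longrightarrow> M * N \<in> gen_grp"
  using generate.eng[of M "GL TYPE('a) d" gens N] by (simp add: gen_grp_def)

lemma h_last_1: "h_last d q (1 :: 'a) = 1\<^sub>m d"
  unfolding h_last_def Let_def by (simp only: bar_1 inverse_1 if_cancel mat_diag_one)

lemma h_last_mult: "h_last d q z * h_last d q w = h_last d q (z * w :: 'a)"
  unfolding h_last_def Let_def mat_diag_diag
  by (rule arg_cong[where f = "mat_diag d"]) (auto simp: fun_eq_iff bar_mult)

lemma h_zero_1: "h_zero d (1 :: 'a) = 1\<^sub>m d"
  unfolding h_zero_def by (simp only: if_cancel mat_diag_one)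

lemma h_zero_mult: "h_zero d z * h_zero d w = h_zero d (z * w :: 'a)"
  unfolding h_zero_def mat_diag_diag
  by (rule arg_cong[where f = "mat_diag d"]) auto

lemma h_last_in_gen_grp:
  assumes "z \<noteq> 0"
  shows "h_last d q z \<in> gen_grp"
proof -
  have pow: "h_last d q (\<zeta> ^ n) \<in> gen_grp" for n
  proof (induction n)
    case 0
    then show ?case using one_in_gen_grp by (simp add: h_last_1)
  next
    case (Suc n)
    have "h_last d q \<zeta> \<in> gen_grp"
      unfolding gen_grp_def gens_def by (blast intro: generate.incl)
    from mult_in_gen_grp[OF this Suc]
    show ?case by (simp add: h_last_mult)
  qed
  have "z \<in> UNIV - {0}" using assms by blast
  then obtain k where "z = \<zeta> powi k" using generator by blast
  moreover have "q ^ 2 - 1 > 0" using one_less_power[OF q_gt_1, of 2] by simp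
  ultimately show ?thesis
    using powi_eq_power_mod[OF power_order_eq_1[OF zeta_nonzero]] pow by simp
qed

lemma h_zero_in_gen_grp:
  assumes "odd d" "z * bar q z = 1"
  shows "h_zero d z \<in> gen_grp"
proof -
  let ?z = "\<zeta> ^ (q - 1)"
  have pow: "h_zero d (?z ^ n) \<in> gen_grp" for n
  proof (induction n)
    case 0
    then show ?case using one_in_gen_grp by (simp add: h_zero_1)
  next
    case (Suc n)
    have "h_zero d ?z \<in> gen_grp"
      unfolding gen_grp_def gens_def using \<open>odd d\<close> by (auto intro: generate.incl)
    from mult_in_gen_grp[OF this Suc]
    show ?case by (simp add: h_zero_mult)
  qed
  obtain k where "z = ?z powi k" using norm_one_group assms by blast
  moreover have "q ^ 2 - 1 > 0" using one_less_power[OF q_gt_1, of 2] by simp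
  \<comment> \<open>A multiple of the order of \<open>?z\<close> suffices to make the exponent
    natural.\<close>
  moreover have "?z ^ (q ^ 2 - 1) = 1" by (rule power_order_eq_1) (simp add: zeta_nonzero)
  ultimately show ?thesis
    using powi_eq_power_mod pow by metis
qed

lemma mult_in_gen_grp_cancel:
  assumes "X \<in> unitary d q" "M \<in> gen_grp" "M * X \<in> gen_grp"
  shows "X \<in> gen_grp"
proof -
  interpret group "GL TYPE('a) d" by (rule GL_group)
  have sub: "subgroup (unitary d q) (GL TYPE('a) d)" by (rule unitary_subgroup)
  have M: "M \<in> carrier (GL TYPE('a) d)" and X: "X \<in> carrier (GL TYPE('a) d)"
    using assms gen_grp_subset_unitary subgroup.mem_carrier[OF sub] by blast+
  have "gens \<subseteq> carrier (GL TYPE('a) d)"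
    using gens_subset_unitary subgroup.subset[OF sub] by blast
  then have "inv\<^bsub>GL TYPE('a) d\<^esub> M \<in> gen_grp"
    using generate_m_inv_closed assms(2) by (simp add: gen_grp_def)
  then have "inv\<^bsub>GL TYPE('a) d\<^esub> M * (M * X) \<in> gen_grp"
    using assms(3) mult_in_gen_grp by blast
  moreover have "inv\<^bsub>GL TYPE('a) d\<^esub> M * (M * X) = X"
    using inv_solve_left[OF X M m_closed[OF M X]] by simp
  ultimately show ?thesis by simp
qed

text \<open>Elimination runs backwards: \<open>X\<close> lies in the group as soon as some
  \<open>M * X\<close> does. The four step rules below pass on only the entries of the new matrix,
  so later arguments compute with columns instead of products.\<close>

lemma reduce:
  assumes "X \<in> unitary d q" "M \<in> gen_grp" "M * X \<in> unitary d q \<Longrightarrow> M * X \<in> gen_grp"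
  shows "X \<in> gen_grp"
proof -
  have "M * X \<in> unitary d q"
    using subgroup.m_closed[OF unitary_subgroup, of M X] assms(1,2) gen_grp_subset_unitary
    by auto
  then show ?thesis using mult_in_gen_grp_cancel assms by blast
qed

lemma short_step:
  assumes X: "X \<in> unitary d q"
    and ab: "a \<in> labels d" "b \<in> labels d" "a \<noteq> 0" "b \<noteq> 0" "a \<noteq> b" "a \<noteq> - b"
    and step: "\<And>Y. Y \<in> unitary d q \<Longrightarrow> (\<And>r c. r \<in> labels d \<Longrightarrow> c \<in> labels d \<Longrightarrow>
      entry d Y r c = short_op q a b t (\<lambda>r. entry d X r c) r) \<Longrightarrow> Y \<in> gen_grp"
  shows "X \<in> gen_grp"
proof (rule reduce[OF X])
  show "short_mat d q a b t \<in> gen_grp"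
    by (intro elementary_in_gen_grp short_mat_elementary ab)
  assume "short_mat d q a b t * X \<in> unitary d q"
  then show "short_mat d q a b t * X \<in> gen_grp"
    by (rule step) (simp add: entry_short_mat unitary_carrier[OF X] ab)
qed

lemma long_step:
  assumes X: "X \<in> unitary d q"
    and a: "a \<in> labels d" "a \<noteq> 0" "s \<in> skew_elems q"
    and step: "\<And>Y. Y \<in> unitary d q \<Longrightarrow> (\<And>r c. r \<in> labels d \<Longrightarrow> c \<in> labels d \<Longrightarrow>
      entry d Y r c = long_op a s (\<lambda>r. entry d X r c) r) \<Longrightarrow> Y \<in> gen_grp"
  shows "X \<in> gen_grp"
proof (rule reduce[OF X])
  show "long_mat d a s \<in> gen_grp"
    by (intro elementary_in_gen_grp long_mat_elementary a)
  assume "long_mat d a s * X \<in> unitary d q"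
  then show "long_mat d a s * X \<in> gen_grp"
    by (rule step) (simp add: entry_long_mat unitary_carrier[OF X] a)
qed

lemma odd_step:
  assumes X: "X \<in> unitary d q"
    and a: "a \<in> labels d" "0 \<in> labels d" "a \<noteq> 0"
    and step: "\<And>Y. Y \<in> unitary d q \<Longrightarrow> (\<And>r c. r \<in> labels d \<Longrightarrow> c \<in> labels d \<Longrightarrow>
      entry d Y r c = odd_op q a t (\<lambda>r. entry d X r c) r) \<Longrightarrow> Y \<in> gen_grp"
  shows "X \<in> gen_grp"
proof (rule reduce[OF X])
  show "odd_mat d q a t \<in> gen_grp"
    by (intro elementary_in_gen_grp odd_mat_elementary a)
  assume "odd_mat d q a t * X \<in> unitary d q"
  then show "odd_mat d q a t * X \<in> gen_grp"
    by (rule step) (simp add: entry_odd_mat unitary_carrier[OF X] a)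
qed

lemma diag_step:
  fixes z :: 'a
  assumes X: "X \<in> unitary d q" and z: "z \<noteq> 0"
    and step: "\<And>Y. Y \<in> unitary d q \<Longrightarrow> (\<And>r c. r \<in> labels d \<Longrightarrow> c \<in> labels d \<Longrightarrow>
      entry d Y r c = (if r = int (d div 2) then z else if r = - int (d div 2)
        then inverse (bar q z) else 1) * entry d X r c) \<Longrightarrow> Y \<in> gen_grp"
  shows "X \<in> gen_grp"
proof (rule reduce[OF X])
  show "h_last d q z \<in> gen_grp" using z by (rule h_last_in_gen_grp)
  have l: "int (d div 2) \<in> labels d" using d_ge by (auto simp: labels_def)
  assume "h_last d q z * X \<in> unitary d q"
  then show "h_last d q z * X \<in> gen_grp"
    by (rule step)
      (use l in \<open>simp add: h_last_def Let_def entry_diag_mult unitary_carrier[OF X] pos_eq_iff\<close>)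
qed

section \<open>Fixed columns and the clearing of a column\<close>

definition fixes_unit :: "'a mat \<Rightarrow> int \<Rightarrow> bool" where
  "fixes_unit X m \<longleftrightarrow> (\<forall>r\<in>labels d. entry d X r m = unit_fun m r)"

lemma fixes_unitD:
  "fixes_unit X m \<Longrightarrow> r \<in> labels d \<Longrightarrow> entry d X r m = (if r = m then 1 else 0)"
  by (simp add: fixes_unit_def unit_fun_def)

lemma herm_columns:
  assumes "X \<in> unitary d q" "a \<in> labels d" "b \<in> labels d"
  shows "herm d q (\<lambda>r. entry d X r a) (\<lambda>r. entry d X r b) = (if b = - a then weight a else (0 :: 'a))"
  using assms by (simp add: unitary_iff)

text \<open>Column \<open>m\<close> is a basis vector, so pairing it with column \<open>c\<close>
  reads off the entry in row \<open>- m\<close>, and unitarity prescribes the result. Fixing a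
  column therefore also fixes the opposite row.\<close>

lemma fixed_row:
  assumes X: "X \<in> unitary d q" and fixed: "fixes_unit X m" and m: "m \<in> labels d" and c: "c \<in> labels d"
  shows "entry d X (- m) c = (if c = - m then 1 else 0)"
proof -
  have "weight m * entry d X (- m) c = herm d q (unit_fun m) (\<lambda>r. entry d X r c)"
    by (simp add: herm_unit_left m)
  also have "\<dots> = herm d q (\<lambda>r. entry d X r m) (\<lambda>r. entry d X r c)"
    by (rule herm_cong) (use fixed in \<open>simp_all add: fixes_unit_def\<close>)
  also have "\<dots> = (if c = - m then weight m else 0)"
    by (rule herm_columns[OF X m c])
  finally show ?thesis using weight_nonzero[OF m] by (auto split: if_splits)
qed

text \<open>Pairing the column with itself shows that its entry in row \<open>- b\<close> is skew.
  The long root element that subtracts this multiple of row \<open>b\<close> is thus available.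
  Columns in \<open>F\<close> vanish in row \<open>b\<close> and do not change.\<close>

lemma clear_opposite:
  assumes X: "X \<in> unitary d q" and b: "b \<in> labels d" "b \<noteq> 0" "entry d X b b = 1"
    and F: "F \<subseteq> labels d" "b \<notin> F" "\<And>m. m \<in> F \<Longrightarrow> fixes_unit X m"
    and supp: "\<And>a. a \<in> labels d \<Longrightarrow> a \<noteq> b \<Longrightarrow> a \<noteq> - b \<Longrightarrow> entry d X a b = 0"
    and rest: "\<And>Y. Y \<in> unitary d q \<Longrightarrow> (\<And>m. m \<in> insert b F \<Longrightarrow> fixes_unit Y m) \<Longrightarrow> Y \<in> gen_grp"
  shows "X \<in> gen_grp"
proof -
  define s where "s = - entry d X (- b) b"
  have nb: "b \<noteq> - b" "- b \<noteq> b" using b by auto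
  have "herm d q (\<lambda>r. entry d X r b) (\<lambda>r. entry d X r b) =
      (\<Sum>r\<in>{b, - b}. bar q (entry d X r b) * weight r * entry d X (- r) b)"
    unfolding herm_def
    by (rule sum.mono_neutral_right) (use b supp in \<open>auto simp: finite_labels bar_0\<close>)
  then have "bar q (entry d X (- b) b) + entry d X (- b) b = 0"
    using herm_columns[OF X b(1) b(1)] nb b by (simp add: weight_def bar_1 add.commute)
  then have "bar q s = - s"
    by (simp add: s_def bar_minus add_eq_0_iff2)
  then have s: "s \<in> skew_elems q" by (simp add: skew_elems_def)
  show ?thesis
  proof (rule long_step[OF X _ _ s, of "- b"])
    fix Y assume Y: "Y \<in> unitary d q" and eY: "\<And>r c. r \<in> labels d \<Longrightarrow> c \<in> labels d \<Longrightarrow>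
      entry d Y r c = long_op (- b) s (\<lambda>r. entry d X r c) r"
    show "Y \<in> gen_grp"
    proof (rule rest[OF Y])
      fix m assume "m \<in> insert b F"
      then consider "m = b" | "m \<in> F" by blast
      then show "fixes_unit Y m"
      proof cases
        case 1
        then show ?thesis
          using b nb supp by (auto simp: fixes_unit_def unit_fun_def eY long_op_def s_def)
      next
        case 2
        then have "m \<noteq> b" "m \<in> labels d" "fixes_unit X m" using F by auto
        then show ?thesis
          using b by (auto simp: fixes_unit_def unit_fun_def eY long_op_def)
      qed
    qed
  qed (use b in auto)
qed

lemma clear_zero:
  assumes X: "X \<in> unitary d q" and b: "b \<in> labels d" "b \<noteq> 0" "entry d X b b = 1"
    and F: "F \<subseteq> labels d" "b \<notin> F" "0 \<notin> F" "\<And>m. m \<in> F \<Longrightarrow> fixes_unit X m"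
    and supp: "\<And>a. a \<in> labels d \<Longrightarrow> a \<noteq> 0 \<Longrightarrow> a \<noteq> b \<Longrightarrow> a \<noteq> - b \<Longrightarrow> entry d X a b = 0"
    and rest: "\<And>Y. Y \<in> unitary d q \<Longrightarrow> (\<And>m. m \<in> insert b F \<Longrightarrow> fixes_unit Y m) \<Longrightarrow> Y \<in> gen_grp"
  shows "X \<in> gen_grp"
proof (cases "0 \<in> labels d")
  case False
  show ?thesis
  proof (rule clear_opposite[OF X b F(1,2,4) _ rest])
    fix a assume "a \<in> labels d" "a \<noteq> b" "a \<noteq> - b"
    with False show "entry d X a b = 0" by (cases "a = 0") (auto intro: supp)
  qed
next
  case zero: True
  have nb: "b \<noteq> - b" "- b \<noteq> b" using b by auto
  show ?thesis
  \<comment> \<open>Row 0 receives \<open>- entry d X 0 b\<close> times row \<open>b\<close>, whose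
    entry is 1. Row \<open>- b\<close> changes too, which is why it is cleared afterwards. Columns
    in \<open>F\<close> vanish in rows 0 and \<open>b\<close>.\<close>
  proof (rule odd_step[OF X _ zero, of "- b" "- entry d X 0 b"])
    fix Y assume Y: "Y \<in> unitary d q" and eY: "\<And>r c. r \<in> labels d \<Longrightarrow> c \<in> labels d \<Longrightarrow>
      entry d Y r c = odd_op q (- b) (- entry d X 0 b) (\<lambda>r. entry d X r c) r"
    show "Y \<in> gen_grp"
    proof (rule clear_opposite[OF Y b(1,2) _ F(1,2) _ _ rest])
      show "entry d Y b b = 1" using b nb by (simp add: eY odd_op_def)
    next
      fix m assume "m \<in> F"
      then have "m \<noteq> b" "m \<noteq> 0" "m \<in> labels d" "fixes_unit X m" using F by auto
      then show "fixes_unit Y m"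
        using b zero by (auto simp: fixes_unit_def unit_fun_def eY odd_op_def)
    next
      fix a assume "a \<in> labels d" "a \<noteq> b" "a \<noteq> - b"
      then show "entry d Y a b = 0"
        using b supp[of a] by (auto simp: eY odd_op_def)
    qed
  qed (use b in auto)
qed

text \<open>Induction on the number of nonzero entries outside rows 0, \<open>b\<close> and
  \<open>- b\<close>. Each operation kills one of them and otherwise disturbs the column only in row
  \<open>- b\<close>, which is not counted.\<close>

lemma clear_column:
  assumes "X \<in> unitary d q" and b: "b \<in> labels d" "b \<noteq> 0" and "entry d X b b = 1"
    and F: "F \<subseteq> labels d" "b \<notin> F" "0 \<notin> F" and "\<And>m. m \<in> F \<Longrightarrow> fixes_unit X m"
    and rest: "\<And>Y. Y \<in> unitary d q \<Longrightarrow> (\<And>m. m \<in> insert b F \<Longrightarrow> fixes_unit Y m) \<Longrightarrow> Y \<in> gen_grp"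
  shows "X \<in> gen_grp"
  using assms(1,4,8)
proof (induction "card {a \<in> labels d. a \<noteq> 0 \<and> a \<noteq> b \<and> a \<noteq> - b \<and> entry d X a b \<noteq> 0}"
    arbitrary: X rule: less_induct)
  case less
  note X = less.prems(1) and Xb = less.prems(2) and fixed = less.prems(3)
  let ?S = "\<lambda>X. {a \<in> labels d. a \<noteq> 0 \<and> a \<noteq> b \<and> a \<noteq> - b \<and> entry d X a b \<noteq> 0}"
  show ?case
  proof (cases "?S X = {}")
    case True
    then show ?thesis
      by (intro clear_zero[OF X b Xb F fixed _ rest]) auto
  next
    case False
    then obtain a where a: "a \<in> labels d" "a \<noteq> 0" "a \<noteq> b" "a \<noteq> - b" "entry d X a b \<noteq> 0"
      by auto
    \<comment> \<open>The operation reads rows \<open>b\<close> and \<open>- a\<close>. Both vanish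
      in the columns of \<open>F\<close> only if \<open>- a\<close> is not among their
      labels.\<close>
    have na: "- a \<notin> F"
    proof
      assume "- a \<in> F"
      then have "entry d X (- (- a)) b = (if b = - (- a) then 1 else 0)"
        by (intro fixed_row[OF X fixed]) (use F b in auto)
      then show False using a by (simp split: if_splits)
    qed
    show ?thesis
    proof (rule short_step[OF X a(1) b(1) a(2) b(2) a(3,4), of "- entry d X a b"])
      fix Y assume Y: "Y \<in> unitary d q" and eY: "\<And>r c. r \<in> labels d \<Longrightarrow> c \<in> labels d \<Longrightarrow>
        entry d Y r c = short_op q a b (- entry d X a b) (\<lambda>r. entry d X r c) r"
      have ab: "entry d Y a b = 0"
        using a b Xb by (simp add: eY short_op_def)
      have other: "entry d Y r b = entry d X r b" if "r \<in> labels d" "r \<noteq> a" "r \<noteq> - b" for r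
        using that b by (simp add: eY short_op_def)
      show "Y \<in> gen_grp"
      proof (rule less.hyps[OF _ Y])
        have "?S Y \<subset> ?S X" using a ab other by fastforce
        then show "card (?S Y) < card (?S X)"
          by (intro psubset_card_mono) (simp_all add: finite_labels)
        show "entry d Y b b = 1" using other[of b] a b Xb by auto
      next
        fix m assume "m \<in> F"
        then have m: "m \<noteq> b" "m \<noteq> - a" "m \<in> labels d" "fixes_unit X m"
          using F fixed na by auto
        then show "fixes_unit Y m"
          using a b by (auto simp: fixes_unit_def unit_fun_def eY short_op_def)
      qed
    qed
  qed
qed

section \<open>One round of elimination\<close>

definition nonzero_labels_below :: "int \<Rightarrow> int set" where
  "nonzero_labels_below k = {m. m \<noteq> 0 \<and> \<bar>m\<bar> < k}"

lemma nonzero_labels_below_subset: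
  "k \<le> int (d div 2) + 1 \<Longrightarrow> nonzero_labels_below k \<subseteq> labels d"
  by (auto simp: nonzero_labels_below_def labels_def)

text \<open>Once column \<open>k\<close> is fixed, \<open>fixed_row\<close> supplies the pivot 1 for
  column \<open>- k\<close>. Clearing that column then preserves column \<open>k\<close>, which has
  joined the fixed ones.\<close>

lemma reduce_pivot_one:
  assumes k: "1 \<le> k" "k \<le> int (d div 2)" and X: "X \<in> unitary d q" and pivot: "entry d X k k = 1"
    and fixed: "\<And>m. m \<in> nonzero_labels_below k \<Longrightarrow> fixes_unit X m"
    and rest: "\<And>Y. Y \<in> unitary d q \<Longrightarrow>
      (\<And>m. m \<in> nonzero_labels_below (k + 1) \<Longrightarrow> fixes_unit Y m) \<Longrightarrow> Y \<in> gen_grp"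
  shows "X \<in> gen_grp"
proof -
  let ?F = "nonzero_labels_below k"
  have F: "?F \<subseteq> labels d" "k \<notin> ?F" "0 \<notin> ?F" "- k \<notin> ?F"
    using nonzero_labels_below_subset[of k] k by (auto simp: nonzero_labels_below_def)
  have kd: "k \<in> labels d" "k \<noteq> 0" using k by (auto simp: labels_def)
  show ?thesis
  proof (rule clear_column[OF X kd pivot F(1-3) fixed])
    fix Y assume Y: "Y \<in> unitary d q" and Y_fix: "\<And>m. m \<in> insert k ?F \<Longrightarrow> fixes_unit Y m"
    show "Y \<in> gen_grp"
    proof (rule clear_column[OF Y, of "- k" "insert k ?F"])
      show "entry d Y (- k) (- k) = 1"
        using fixed_row[OF Y Y_fix[of k] kd(1), of "- k"] kd by simp
    next
      fix Z assume Z: "Z \<in> unitary d q"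
        and Z_fix: "\<And>m. m \<in> insert (- k) (insert k ?F) \<Longrightarrow> fixes_unit Z m"
      show "Z \<in> gen_grp"
      proof (rule rest[OF Z])
        fix m assume "m \<in> nonzero_labels_below (k + 1)"
        then show "fixes_unit Z m"
          by (intro Z_fix) (auto simp: nonzero_labels_below_def)
      qed
    qed (use kd F Y_fix in auto)
  qed
qed

lemma reduce_last_nonzero:
  assumes k: "1 \<le> k" "k \<le> int (d div 2)" and X: "X \<in> unitary d q"
    and nz: "entry d X (int (d div 2)) k \<noteq> 0"
    and fixed: "\<And>m. m \<in> nonzero_labels_below k \<Longrightarrow> fixes_unit X m"
    and rest: "\<And>Y. Y \<in> unitary d q \<Longrightarrow>
      (\<And>m. m \<in> nonzero_labels_below (k + 1) \<Longrightarrow> fixes_unit Y m) \<Longrightarrow> Y \<in> gen_grp"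
  shows "X \<in> gen_grp"
proof -
  let ?l = "int (d div 2)"
  have kd: "k \<in> labels d" "?l \<in> labels d" using k by (auto simp: labels_def)
  have F: "m \<in> labels d" "m \<noteq> k" "m \<noteq> - k" "m \<noteq> ?l" "m \<noteq> - ?l"
    if "m \<in> nonzero_labels_below k" for m
    using that nonzero_labels_below_subset[of k] k by (auto simp: nonzero_labels_below_def)
  show ?thesis
  proof (cases "k = ?l")
    case True
    show ?thesis
    \<comment> \<open>The available diagonal matrices rescale row l, which is the pivot row exactly
      when \<open>k\<close> is l.\<close>
    proof (rule diag_step[OF X, of "inverse (entry d X k k)"])
      show "inverse (entry d X k k) \<noteq> 0" using nz True by simp
    next
      fix Y assume Y: "Y \<in> unitary d q" and eY: "\<And>r c. r \<in> labels d \<Longrightarrow> c \<in> labels d \<Longrightarrow>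
        entry d Y r c = (if r = ?l then inverse (entry d X k k) else if r = - ?l
          then inverse (bar q (inverse (entry d X k k))) else 1) * entry d X r c"
      show "Y \<in> gen_grp"
      proof (rule reduce_pivot_one[OF k Y _ _ rest])
        show "entry d Y k k = 1" using kd nz True by (simp add: eY)
      next
        fix m assume m: "m \<in> nonzero_labels_below k"
        then show "fixes_unit Y m"
          using F[OF m] fixed[OF m] by (auto simp: fixes_unit_def unit_fun_def eY)
      qed
    qed
  next
    case False
    \<comment> \<open>Adding \<open>?t\<close> times row l to row \<open>k\<close> makes the pivot
      1. The accompanying change in row -l uses row \<open>- k\<close>, which vanishes in the fixed
      columns.\<close>
    let ?t = "(1 - entry d X k k) / entry d X ?l k"
    show ?thesis
    proof (rule short_step[OF X kd, of ?t])
      fix Y assume Y: "Y \<in> unitary d q" and eY: "\<And>r c. r \<in> labels d \<Longrightarrow> c \<in> labels d \<Longrightarrow>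
        entry d Y r c = short_op q k ?l ?t (\<lambda>r. entry d X r c) r"
      show "Y \<in> gen_grp"
      proof (rule reduce_pivot_one[OF k Y _ _ rest])
        show "entry d Y k k = 1" using k kd nz by (simp add: eY short_op_def)
      next
        fix m assume m: "m \<in> nonzero_labels_below k"
        then show "fixes_unit Y m"
          using F[OF m] fixed[OF m] kd by (auto simp: fixes_unit_def unit_fun_def eY short_op_def)
      qed
    qed (use k False in auto)
  qed
qed

text \<open>A column supported at label 0 would be zero, being isotropic while
  \<open>weight 0\<close> is nonzero. But its pairing with column \<open>- k\<close> is
  nonzero.\<close>

lemma column_nonzero_off_zero:
  fixes X :: "'a mat"
  assumes X: "X \<in> unitary d q" and k: "k \<in> labels d" "k \<noteq> 0"
  obtains a where "a \<in> labels d" "a \<noteq> 0" "entry d X a k \<noteq> 0"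
proof -
  have False if *: "\<And>a. a \<in> labels d \<Longrightarrow> a \<noteq> 0 \<Longrightarrow> entry d X a k = 0"
  proof -
    have supp: "herm d q (\<lambda>r. entry d X r k) g =
        (\<Sum>r\<in>labels d \<inter> {0}. bar q (entry d X r k) * weight r * g (- r))" for g
      unfolding herm_def
      by (rule sum.mono_neutral_right) (use * in \<open>auto simp: finite_labels bar_0\<close>)
    have zero: "entry d X 0 k = 0" if "0 \<in> labels d"
      using supp[of "\<lambda>r. entry d X r k"] herm_columns[OF X k(1) k(1)] k that
        weight_nonzero[of 0] by (simp add: bar_eq_0)
    have "herm d q (\<lambda>r. entry d X r k) (\<lambda>r. entry d X r (- k)) = 0"
      unfolding supp by (rule sum.neutral) (use zero in \<open>auto simp: bar_0\<close>)
    then show False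
      using herm_columns[OF X, of k "- k"] k weight_nonzero[of k] by simp
  qed
  then show thesis using that by blast
qed

lemma reduce_step:
  assumes k: "1 \<le> k" "k \<le> int (d div 2)" and X: "X \<in> unitary d q"
    and fixed: "\<And>m. m \<in> nonzero_labels_below k \<Longrightarrow> fixes_unit X m"
    and rest: "\<And>Y. Y \<in> unitary d q \<Longrightarrow>
      (\<And>m. m \<in> nonzero_labels_below (k + 1) \<Longrightarrow> fixes_unit Y m) \<Longrightarrow> Y \<in> gen_grp"
  shows "X \<in> gen_grp"
proof (cases "entry d X (int (d div 2)) k = 0")
  case False
  then show ?thesis using reduce_last_nonzero[OF k X _ fixed rest] by blast
next
  case l0: True
  let ?l = "int (d div 2)"
  have kd: "k \<in> labels d" "k \<noteq> 0" "?l \<in> labels d" "?l \<noteq> 0" using k by (auto simp: labels_def)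
  have F: "m \<in> labels d" "- m \<in> nonzero_labels_below k" "m \<noteq> k" "m \<noteq> - k" "m \<noteq> ?l" "m \<noteq> - ?l"
    if "m \<in> nonzero_labels_below k" for m
    using that nonzero_labels_below_subset[of k] k by (auto simp: nonzero_labels_below_def)
  obtain a where a: "a \<in> labels d" "a \<noteq> 0" "entry d X a k \<noteq> 0"
    using column_nonzero_off_zero[OF X kd(1,2)] .
  \<comment> \<open>Otherwise column \<open>- a\<close> would be fixed too, and
    \<open>fixed_row\<close> would make the entry of column \<open>k\<close> in row \<open>a\<close>
    vanish.\<close>
  have aF: "a \<notin> nonzero_labels_below k"
  proof
    assume "a \<in> nonzero_labels_below k"
    then have "entry d X (- (- a)) k = (if k = - (- a) then 1 else 0)"
      by (intro fixed_row[OF X fixed]) (use F kd in auto)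
    then show False using a F[OF \<open>a \<in> nonzero_labels_below k\<close>] by (simp split: if_splits)
  qed
  show ?thesis
  \<comment> \<open>No short root element carries row -l to row l, so a long one with nonzero skew
    parameter does it. From any other row \<open>a\<close> a short one with parameter 1 works, as
    the entry in row l is 0.\<close>
  proof (cases "a = - ?l")
    case True
    obtain s :: 'a where s: "s \<in> skew_elems q" "s \<noteq> 0" by (rule obtain_skew)
    show ?thesis
    proof (rule long_step[OF X kd(3,4) s(1)])
      fix Y assume Y: "Y \<in> unitary d q" and eY: "\<And>r c. r \<in> labels d \<Longrightarrow> c \<in> labels d \<Longrightarrow>
        entry d Y r c = long_op ?l s (\<lambda>r. entry d X r c) r"
      show "Y \<in> gen_grp"
      proof (rule reduce_last_nonzero[OF k Y _ _ rest])
        show "entry d Y ?l k \<noteq> 0" using kd s a True by (simp add: eY long_op_def l0)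
      next
        fix m assume m: "m \<in> nonzero_labels_below k"
        then show "fixes_unit Y m"
          using F[OF m] fixed[OF m] kd by (auto simp: fixes_unit_def unit_fun_def eY long_op_def)
      qed
    qed
  next
    case False
    have "?l \<noteq> a" using a l0 by auto
    show ?thesis
    proof (rule short_step[OF X kd(3) a(1) kd(4) a(2) \<open>?l \<noteq> a\<close>, of 1])
      show "?l \<noteq> - a" using False by auto
    next
      fix Y assume Y: "Y \<in> unitary d q" and eY: "\<And>r c. r \<in> labels d \<Longrightarrow> c \<in> labels d \<Longrightarrow>
        entry d Y r c = short_op q ?l a 1 (\<lambda>r. entry d X r c) r"
      show "Y \<in> gen_grp"
      proof (rule reduce_last_nonzero[OF k Y _ _ rest])
        have "?l \<noteq> - a" using False by auto
        then show "entry d Y ?l k \<noteq> 0" using kd a by (simp add: eY short_op_def l0)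
      next
        fix m assume m: "m \<in> nonzero_labels_below k"
        then have "m \<noteq> a" using aF by auto
        then show "fixes_unit Y m"
          using F[OF m] fixed[OF m] kd a by (auto simp: fixes_unit_def unit_fun_def eY short_op_def)
      qed
    qed
  qed
qed

text \<open>Only column 0 can still differ from the identity. By \<open>fixed_row\<close> it
  vanishes off label 0, and its pairing with itself forces the remaining entry to have norm
  1.\<close>

lemma fixes_all_in_gen_grp:
  assumes X: "X \<in> unitary d q"
    and fixed: "\<And>m. m \<in> labels d \<Longrightarrow> m \<noteq> 0 \<Longrightarrow> fixes_unit X m"
  shows "X \<in> gen_grp"
proof (cases "odd d")
  case False
  have "X = 1\<^sub>m d"
  proof (rule mat_eqI_entry[OF unitary_carrier[OF X] one_carrier_mat])
    fix r c assume "r \<in> labels d" "c \<in> labels d"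
    then show "entry d X r c = entry d (1\<^sub>m d) r c"
      using fixes_unitD[OF fixed] False zero_label by (cases "c = 0") (auto simp: entry_one)
  qed
  then show ?thesis using one_in_gen_grp by simp
next
  case True
  then have z: "0 \<in> labels d" by (simp add: zero_label)
  let ?x = "entry d X 0 0"
  have row: "entry d X r 0 = 0" if "r \<in> labels d" "r \<noteq> 0" for r
    using fixed_row[OF X fixed, of "- r" 0] that z by simp
  have "herm d q (\<lambda>r. entry d X r 0) (\<lambda>r. entry d X r 0) =
      (\<Sum>r\<in>{0}. bar q (entry d X r 0) * weight r * entry d X (- r) 0)"
    unfolding herm_def
    by (rule sum.mono_neutral_right) (use z row in \<open>auto simp: finite_labels bar_0\<close>)
  then have "bar q ?x * weight 0 * ?x = weight 0"
    using herm_columns[OF X z z] by simp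
  then have x: "?x * bar q ?x = 1"
    using weight_nonzero[OF z] by (simp add: mult_ac)
  have "X = h_zero d ?x"
  proof (rule mat_eqI_entry[OF unitary_carrier[OF X]])
    show "h_zero d ?x \<in> carrier_mat d d" by (simp add: h_zero_def)
    fix r c assume "r \<in> labels d" "c \<in> labels d"
    then show "entry d X r c = entry d (h_zero d ?x) r c"
      using fixes_unitD[OF fixed] row z
      by (cases "c = 0") (auto simp: h_zero_def entry_diag pos_eq_iff)
  qed
  then show ?thesis using h_zero_in_gen_grp[OF True x] by simp
qed

text \<open>\<open>n\<close> counts the rounds still to come. With \<open>n\<close> =
  \<open>d div 2\<close> no column is assumed fixed, and with \<open>n\<close> = 0 all columns with
  nonzero label are.\<close>

lemma unitary_fixing_below_in_gen_grp:
  assumes "int n \<le> int (d div 2)" "X \<in> unitary d q"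
    and "\<And>m. m \<in> nonzero_labels_below (int (d div 2) + 1 - int n) \<Longrightarrow> fixes_unit X m"
  shows "X \<in> gen_grp"
  using assms
proof (induction n arbitrary: X)
  case 0
  show ?case
    by (rule fixes_all_in_gen_grp[OF 0(2)], rule 0(3))
      (auto simp: nonzero_labels_below_def labels_def)
next
  case (Suc n)
  have shift: "int (d div 2) + 1 - int (Suc n) + 1 = int (d div 2) + 1 - int n" by simp
  show ?case
  proof (rule reduce_step[OF _ _ Suc.prems(2,3)])
    fix Y assume "Y \<in> unitary d q"
      "\<And>m. m \<in> nonzero_labels_below (int (d div 2) + 1 - int (Suc n) + 1) \<Longrightarrow> fixes_unit Y m"
    then show "Y \<in> gen_grp" unfolding shift using Suc.IH[of Y] Suc.prems(1) by simp
  qed (use Suc.prems(1) in auto)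
qed

theorem gen_grp_eq_unitary: "gen_grp = unitary d q"
proof
  show "unitary d q \<subseteq> gen_grp"
    by (rule subsetI, rule unitary_fixing_below_in_gen_grp[of "d div 2"])
      (auto simp: nonzero_labels_below_def)
qed (rule gen_grp_subset_unitary)

end

theorem theorem6p1:
  fixes \<zeta> \<zeta>1 :: "'a::field" and q d :: nat
  assumes "primepow q"
    and "CARD('a) = q ^ 2"
    and "d \<ge> 4"
    and "odd d \<longrightarrow> odd q"
    and "range (\<lambda>k::int. \<zeta> powi k) = UNIV - {0}"
    and "\<zeta>1 = \<zeta> ^ (q - 1)"
  shows "range (\<lambda>k::int. \<zeta>1 powi k) = {x. x * bar q x = 1} \<and>
    (\<forall>l. d = 2 * l \<longrightarrow>
      generate (GL TYPE('a) d) (elementary d q \<union> {h_last d q \<zeta>}) = unitary d q) \<and>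
    (\<forall>l. d = 2 * l + 1 \<longrightarrow>
      generate (GL TYPE('a) d) (elementary d q \<union> {h_last d q \<zeta>, h_zero d \<zeta>1}) = unitary d q)"
proof -
  interpret finite_unitary q d \<zeta>
    by unfold_locales (use assms in auto)
  have even: "gens = elementary d q \<union> {h_last d q \<zeta>}" if "d = 2 * l" for l
  proof -
    have "even d" using that by simp
    then show ?thesis by (simp add: gens_def)
  qed
  have odd: "gens = elementary d q \<union> {h_last d q \<zeta>, h_zero d \<zeta>1}" if "d = 2 * l + 1" for l
  proof -
    have "odd d" using that by simp
    then show ?thesis by (auto simp: gens_def assms(6))
  qed
  show ?thesis
    using norm_one_group gen_grp_eq_unitary
    unfolding gen_grp_def assms(6) using even odd assms(6) by auto
qed

end
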